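(* The limits $c_1=\lim_{k\to\infty}f_1(k)$ and $c_2=\lim_{k\to\infty}\min\{f_1(k),f_2(k)\}$ exist.
   Context: For a bounded region $Q\subset\mathbb{R}^2$ and a positive integer $k$, let $\mathcal{P}_Q$ be a Poisson process of intensity one in $Q$, and let $G_{Q,k}$ be the undirected graph on $\mathcal{P}_Q$ in which $x,y$ are adjacent if $y$ is one of the $k$ nearest neighbours of $x$ (among points of $\mathcal{P}_Q$) or vice versa. Let $S_n$ be a square of area $n$ and $G_{n,k}=G_{S_n,k}$. Let $M$ be a fixed real constant with $M\ge 40$ such that, whenever $0.30\log n<k<0.52\log n$, the probability that $G_{n,k}$ contains two components each of Euclidean diameter greater than $\frac18 M\sqrt{k}$ is $o(e^{-9k})$ as $k\to\infty$. Let $S=[-\frac12M\sqrt k,\frac12M\sqrt k]^2$ and $S'=\frac12 S$; $A_k$ is the event that $G_{S,k}$ has a connected component all of whose vertices lie in $S'$. Let $R=[0,M\sqrt k]\times[-\frac12M\sqrt k,\frac12M\sqrt k]$ and $R'=\frac12R$; $B_k$ is the event that $G_{R,k}$ has a connected component all of whose vertices lie in $R'$. Put $p_1(k)=\Pr(A_k)$, $p_2(k)=\Pr(B_k)$, $f_1(k)=-\log p_1(k)/k$, $f_2(k)=-\log p_2(k)/k$. *)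

theory Defs
  imports "HOL-Analysis.Analysis"
begin

type_synonym pt = "real \<times> real"

text \<open>Poisson process of intensity one in a bounded region Q: the probability of an event E
  (a property of the finite point configuration) is given by the standard Janossy-density
  representation: the number of points N is Poisson with mean |Q|, and given N = n the
  points are i.i.d. uniform in Q.\<close>
definition poisson_prob :: "pt set \<Rightarrow> (pt set \<Rightarrow> bool) \<Rightarrow> real" where
  "poisson_prob Q E =
     (\<Sum>n. exp (- measure lborel Q) / fact n *
        measure (PiM {..<n} (\<lambda>_. (lborel :: pt measure)))
                {x \<in> {..<n} \<rightarrow>\<^sub>E Q. E (x ` {..<n})})"

definition is_knn :: "nat \<Rightarrow> pt set \<Rightarrow> pt \<Rightarrow> pt \<Rightarrow> bool" where
  "is_knn k P x y \<longleftrightarrow> y \<in> P \<and> y \<noteq> x \<and> card {z \<in> P - {x}. dist x z < dist x y} < k"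

definition knn_adj :: "nat \<Rightarrow> pt set \<Rightarrow> pt \<Rightarrow> pt \<Rightarrow> bool" where
  "knn_adj k P x y \<longleftrightarrow> x \<in> P \<and> y \<in> P \<and> (is_knn k P x y \<or> is_knn k P y x)"

definition knn_components :: "nat \<Rightarrow> pt set \<Rightarrow> pt set set" where
  "knn_components k P = {{y. (knn_adj k P)\<^sup>*\<^sup>* x y} | x. x \<in> P}"

definition Sq :: "nat \<Rightarrow> pt set" where
  "Sq n = {(x, y). 0 \<le> x \<and> x \<le> sqrt (real n) \<and> 0 \<le> y \<and> y \<le> sqrt (real n)}"

definition two_big_components :: "real \<Rightarrow> nat \<Rightarrow> pt set \<Rightarrow> bool" where
  "two_big_components M k P \<longleftrightarrow>
     (\<exists>C1 \<in> knn_components k P. \<exists>C2 \<in> knn_components k P. C1 \<noteq> C2 \<and>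
        diameter C1 > M * sqrt (real k) / 8 \<and> diameter C2 > M * sqrt (real k) / 8)"

definition good_M :: "real \<Rightarrow> bool" where
  "good_M M \<longleftrightarrow> M \<ge> 40 \<and>
     (\<forall>\<epsilon>>0. \<exists>K. \<forall>k\<ge>K. \<forall>n::nat.
        (3/10) * ln (real n) < real k \<and> real k < (52/100) * ln (real n) \<longrightarrow>
        poisson_prob (Sq n) (two_big_components M k) \<le> \<epsilon> * exp (- 9 * real k))"

definition boxS :: "real \<Rightarrow> nat \<Rightarrow> pt set" where
  "boxS M k = {(x, y). \<bar>x\<bar> \<le> M * sqrt (real k) / 2 \<and> \<bar>y\<bar> \<le> M * sqrt (real k) / 2}"

definition boxS' :: "real \<Rightarrow> nat \<Rightarrow> pt set" where
  "boxS' M k = {(x, y). \<bar>x\<bar> \<le> M * sqrt (real k) / 4 \<and> \<bar>y\<bar> \<le> M * sqrt (real k) / 4}"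

definition boxR :: "real \<Rightarrow> nat \<Rightarrow> pt set" where
  "boxR M k = {(x, y). 0 \<le> x \<and> x \<le> M * sqrt (real k) \<and> \<bar>y\<bar> \<le> M * sqrt (real k) / 2}"

definition boxR' :: "real \<Rightarrow> nat \<Rightarrow> pt set" where
  "boxR' M k = {(x, y). 0 \<le> x \<and> x \<le> M * sqrt (real k) / 2 \<and> \<bar>y\<bar> \<le> M * sqrt (real k) / 4}"

definition p1 :: "real \<Rightarrow> nat \<Rightarrow> real" where
  "p1 M k = poisson_prob (boxS M k) (\<lambda>P. \<exists>C \<in> knn_components k P. C \<subseteq> boxS' M k)"

definition p2 :: "real \<Rightarrow> nat \<Rightarrow> real" where
  "p2 M k = poisson_prob (boxR M k) (\<lambda>P. \<exists>C \<in> knn_components k P. C \<subseteq> boxR' M k)"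

definition f1 :: "real \<Rightarrow> nat \<Rightarrow> real" where
  "f1 M k = - ln (p1 M k) / real k"

definition f2 :: "real \<Rightarrow> nat \<Rightarrow> real" where
  "f2 M k = - ln (p2 M k) / real k"

end

theory Submission
  imports Defs
begin

text \<open>
  Rescaling the box by \<open>1 / sqrt k\<close> turns \<open>p1\<close> and \<open>p2\<close> into probabilities for a Poisson process of
  intensity \<open>k\<close> in a fixed window. A configuration has a component inside the core iff it has a nonempty
  part there that no edge leaves, that is, for \<open>x\<close> in the part and \<open>y\<close> outside it the balls around \<open>x\<close>
  and around \<open>y\<close> of radius \<open>dist x y\<close> both contain \<open>k\<close> further points.

  Superpose \<open>m\<close> independent copies of the process of intensity \<open>k\<close>, all having such a part, with the parts
  (and likewise their complements) occupying the same cells of a fine grid. The union of the parts is a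
  part of the same kind for the union of the configurations, with threshold close to \<open>m k\<close>: the radius of
  a ball varies between copies by a bounded number of cell widths, so only points of a thin annulus are lost,
  and thin annuli contain few points by a Chernoff bound. The number of grid patterns does not
  depend on \<open>k\<close>, so fixing the pattern costs a constant factor, and changing the intensity from \<open>m k\<close> to a
  slightly smaller \<open>K\<close> costs a factor \<open>exp (- \<epsilon> K)\<close>. Hence the rate at every large \<open>K\<close> is at most the rate
  at \<open>k\<close> plus \<open>\<epsilon>\<close>; the rates are bounded, so they converge. This applies to both boxes separately.
\<close>

section \<open>Parts of the graph without outgoing edges\<close>

text \<open>A nonempty union of components. It is described by conditions on pairs of points,
  without a transitive closure; this suits both measurability and unions over copies.\<close>

definition isolated_part :: "nat \<Rightarrow> pt set \<Rightarrow> pt set \<Rightarrow> bool" where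
  "isolated_part k P C \<longleftrightarrow> C \<subseteq> P \<and> C \<noteq> {} \<and> (\<forall>x\<in>C. \<forall>y\<in>P - C. \<not> knn_adj k P x y)"

text \<open>For \<open>y \<noteq> x\<close> in \<open>P\<close> this is the negation of
  \<open>is_knn k P x y\<close>. The ball is open, so neither its centre \<open>x\<close> nor the
  boundary point \<open>y\<close> is counted.\<close>

definition crowded :: "nat \<Rightarrow> pt set \<Rightarrow> pt \<Rightarrow> pt \<Rightarrow> bool" where
  "crowded k P x y \<longleftrightarrow> k \<le> card {z \<in> P - {x}. dist x z < dist x y}"

text \<open>The width is \<open>7 * \<rho>\<close> because the radius of a ball is off by up to \<open>4 * \<rho>\<close> between two copies,
  the two centres are each within \<open>\<rho>\<close> of the grid point \<open>z\<close>, and the inner radius is rounded down to a multiple of \<open>\<rho>\<close>.\<close>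
definition annulus :: "real \<Rightarrow> pt \<Rightarrow> nat \<Rightarrow> pt set" where
  "annulus \<rho> z j = ball z (real (j + 7) * \<rho>) - ball z (real j * \<rho>)"

lemma not_knn_adj_iff_crowded:
  assumes "x \<in> P" "y \<in> P" "x \<noteq> y"
  shows "\<not> knn_adj k P x y \<longleftrightarrow> crowded k P x y \<and> crowded k P y x"
  using assms by (auto simp: knn_adj_def is_knn_def crowded_def)

text \<open>A component has no outgoing edge. Conversely, a walk that starts in an isolated part can
  never leave it, so the component of any of its points lies inside it.\<close>

lemma component_inside_iff_isolated_part:
  "(\<exists>C \<in> knn_components k P. C \<subseteq> V) \<longleftrightarrow> (\<exists>C. isolated_part k P C \<and> C \<subseteq> V)"
proof
  assume "\<exists>C \<in> knn_components k P. C \<subseteq> V"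
  then obtain x where x: "x \<in> P" "{y. (knn_adj k P)\<^sup>*\<^sup>* x y} \<subseteq> V"
    by (auto simp: knn_components_def)
  let ?C = "{y. (knn_adj k P)\<^sup>*\<^sup>* x y}"
  have "y \<in> P" if "(knn_adj k P)\<^sup>*\<^sup>* x y" for y
    using that x(1) by (induction rule: rtranclp_induct) (auto simp: knn_adj_def)
  then have "isolated_part k P ?C"
    unfolding isolated_part_def using x(1)
    by (blast intro: rtranclp.rtrancl_refl rtranclp.rtrancl_into_rtrancl)
  with x show "\<exists>C. isolated_part k P C \<and> C \<subseteq> V" by blast
next
  assume "\<exists>C. isolated_part k P C \<and> C \<subseteq> V"
  then obtain C x where C: "isolated_part k P C" "C \<subseteq> V" "x \<in> C"
    by (auto simp: isolated_part_def)
  have "y \<in> C" if "(knn_adj k P)\<^sup>*\<^sup>* x y" for y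
    using that
  proof (induction rule: rtranclp_induct)
    case (step y z)
    then have "z \<in> P" by (auto simp: knn_adj_def)
    with step C show ?case unfolding isolated_part_def by blast
  qed (use C in simp)
  moreover have "x \<in> P" using C by (auto simp: isolated_part_def)
  ultimately show "\<exists>C \<in> knn_components k P. C \<subseteq> V"
    using C(2) unfolding knn_components_def
    by (intro bexI[of _ "{y. (knn_adj k P)\<^sup>*\<^sup>* x y}"] CollectI exI[of _ x] conjI refl subsetI) blast+
qed

section \<open>Invariance of the graph under scaling\<close>

lemma dist_scaleR_less_iff:
  fixes x :: "'a::real_normed_vector"
  assumes "s > 0"
  shows "dist (s *\<^sub>R x) (s *\<^sub>R z) < dist (s *\<^sub>R x) (s *\<^sub>R y) \<longleftrightarrow> dist x z < dist x y"
  using assms by (simp add: dist_norm flip: scaleR_diff_right)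

lemma crowded_scaleR:
  assumes "s > 0"
  shows "crowded k ((*\<^sub>R) s ` P) (s *\<^sub>R x) (s *\<^sub>R y) \<longleftrightarrow> crowded k P x y"
proof -
  have "{z \<in> (*\<^sub>R) s ` P - {s *\<^sub>R x}. dist (s *\<^sub>R x) z < dist (s *\<^sub>R x) (s *\<^sub>R y)}
      = (*\<^sub>R) s ` {z \<in> P - {x}. dist x z < dist x y}"
    using assms dist_scaleR_less_iff[OF assms, of x _ y] by (auto simp del: scaleR_Pair simp: image_iff)
  moreover have "inj_on ((*\<^sub>R) s) A" for A :: "pt set"
    using assms by (auto simp: inj_on_def)
  ultimately show ?thesis by (simp add: crowded_def card_image)
qed

lemma knn_adj_scaleR:
  assumes "s > 0"
  shows "knn_adj k ((*\<^sub>R) s ` P) (s *\<^sub>R x) (s *\<^sub>R y) \<longleftrightarrow> knn_adj k P x y"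
proof (cases "x \<in> P \<and> y \<in> P \<and> x \<noteq> y")
  case True
  then have "s *\<^sub>R x \<in> (*\<^sub>R) s ` P" "s *\<^sub>R y \<in> (*\<^sub>R) s ` P" "s *\<^sub>R x \<noteq> s *\<^sub>R y"
    using assms by auto
  with True show ?thesis
    using not_knn_adj_iff_crowded crowded_scaleR[OF assms] by metis
next
  case False
  with assms show ?thesis by (auto simp: knn_adj_def is_knn_def image_iff)
qed

lemma isolated_part_scaleR:
  assumes "s > 0"
  shows "isolated_part k ((*\<^sub>R) s ` P) ((*\<^sub>R) s ` C) \<longleftrightarrow> isolated_part k P C"
proof -
  have inj: "inj ((*\<^sub>R) s :: pt \<Rightarrow> pt)" using assms by (auto simp: inj_on_def)
  show ?thesis
    unfolding isolated_part_def image_set_diff[OF inj, symmetric] ball_simps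
      knn_adj_scaleR[OF assms]
    using inj by (simp add: inj_image_subset_iff)
qed

lemma ex_isolated_part_scaleR:
  assumes "s > 0"
  shows "(\<exists>C. isolated_part k ((*\<^sub>R) s ` P) C \<and> C \<subseteq> (*\<^sub>R) s ` V)
    \<longleftrightarrow> (\<exists>C. isolated_part k P C \<and> C \<subseteq> V)"
proof
  have inj: "inj ((*\<^sub>R) s :: pt \<Rightarrow> pt)" using assms by (auto simp: inj_on_def)
  assume "\<exists>C. isolated_part k ((*\<^sub>R) s ` P) C \<and> C \<subseteq> (*\<^sub>R) s ` V"
  then obtain C where C: "isolated_part k ((*\<^sub>R) s ` P) C" "C \<subseteq> (*\<^sub>R) s ` V" by blast
  then obtain D where "C = (*\<^sub>R) s ` D" "D \<subseteq> V" by (meson subset_imageE)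
  with C show "\<exists>C. isolated_part k P C \<and> C \<subseteq> V"
    using isolated_part_scaleR[OF assms] by blast
next
  assume "\<exists>C. isolated_part k P C \<and> C \<subseteq> V"
  then show "\<exists>C. isolated_part k ((*\<^sub>R) s ` P) C \<and> C \<subseteq> (*\<^sub>R) s ` V"
    using isolated_part_scaleR[OF assms] by (meson image_mono)
qed

section \<open>Comparing balls of different copies and merging the parts\<close>

lemma ball_card_transfer:
  assumes "finite P" "crowded k P x' y'"
    and "dist z x \<le> \<rho>" "dist z x' \<le> \<rho>" "dist x' y' \<le> dist x y + 4 * \<rho>" "\<rho> > 0"
    and b: "card (P \<inter> annulus \<rho> z (nat \<lfloor>dist x y / \<rho>\<rfloor> - 1)) \<le> b"
  shows "k \<le> card {w \<in> P. dist x w < dist x y} + b"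
proof -
  define t where "t = dist x y / \<rho>"
  have t: "dist x y = t * \<rho>" "t \<ge> 0" using assms by (auto simp: t_def)
  \<comment> \<open>Either \<open>real j \<le> t - 1\<close>, which leaves room for the offset
    between \<open>x\<close> and \<open>z\<close>, or \<open>j = 0\<close> (possibly by truncated
    subtraction) and the inner ball is empty.\<close>
  define j where "j = nat \<lfloor>t\<rfloor> - 1"
  have j6: "t + 5 \<le> real (j + 7)" unfolding j_def by linarith
  have j0: "real j \<le> t - 1 \<or> j = 0" unfolding j_def using \<open>t \<ge> 0\<close> by linarith
  \<comment> \<open>A point counted for \<open>x'\<close> is within
    \<open>dist x y + 5 * \<rho>\<close> of \<open>z\<close>, hence inside the outer radius. Outside
    the annulus it is within \<open>dist x y - \<rho>\<close> of \<open>z\<close>, hence in the ball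
    around \<open>x\<close>. Only points of the annulus are lost.\<close>
  have "{w \<in> P - {x'}. dist x' w < dist x' y'} \<subseteq> {w \<in> P. dist x w < dist x y} \<union> (P \<inter> annulus \<rho> z j)"
  proof safe
    fix w assume w: "w \<in> P" "dist x' w < dist x' y'" "w \<notin> annulus \<rho> z j"
    have "dist z w \<le> dist z x' + dist x' w" by (rule dist_triangle)
    then have "dist z w < t * \<rho> + 5 * \<rho>" using assms w t by linarith
    also have "\<dots> \<le> real (j + 7) * \<rho>"
      using j6 \<open>\<rho> > 0\<close> by (metis distrib_right mult_right_mono less_imp_le)
    finally have "dist z w < real j * \<rho>"
      using w(3) by (auto simp: annulus_def)
    then have "j \<noteq> 0" using zero_le_dist[of z w] by (metis linorder_not_less mult_zero_left of_nat_0)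
    with j0 have "real j * \<rho> \<le> (t - 1) * \<rho>" using \<open>\<rho> > 0\<close> by (intro mult_right_mono) auto
    then have "dist z w < dist x y - \<rho>"
      using \<open>dist z w < real j * \<rho>\<close> t by (simp add: algebra_simps)
    moreover have "dist x w \<le> dist z x + dist z w"
      by (metis dist_commute dist_triangle)
    ultimately show "dist x w < dist x y" using assms by linarith
  qed
  then have "card {w \<in> P - {x'}. dist x' w < dist x' y'}
      \<le> card ({w \<in> P. dist x w < dist x y} \<union> (P \<inter> annulus \<rho> z j))"
    using assms(1) by (intro card_mono) auto
  also have "\<dots> \<le> card {w \<in> P. dist x w < dist x y} + card (P \<inter> annulus \<rho> z j)"
    by (rule card_Un_le)
  finally show ?thesis using assms(2) b by (simp add: crowded_def j_def t_def)
qed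

text \<open>For \<open>x\<close> in the union of the parts and \<open>y\<close> outside it, each
  copy has representatives of both in the same cells, with crowded balls. Transferring them to the
  ball around \<open>x\<close> through \<open>y\<close> gives at least \<open>k - b\<close> points
  per copy, and these counts add up over the disjoint copies. The roles of \<open>x\<close> and
  \<open>y\<close> can be exchanged.\<close>

lemma isolated_part_UN:
  fixes P C :: "nat \<Rightarrow> pt set" and g :: "pt \<Rightarrow> pt"
  assumes "m > 0" "\<rho> > 0"
    and fin: "\<And>l. l < m \<Longrightarrow> finite (P l)"
    and disj: "disjoint_family_on P {..<m}"
    and iso: "\<And>l. l < m \<Longrightarrow> isolated_part k (P l) (C l)"
    and inner: "\<And>l. l < m \<Longrightarrow> g ` C l = \<alpha>"
    and outer: "\<And>l. l < m \<Longrightarrow> g ` (P l - C l) = \<beta>"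
    and g: "\<And>l w. l < m \<Longrightarrow> w \<in> P l \<Longrightarrow> dist (g w) w \<le> \<rho>"
    and far: "\<And>l l' v w. l < m \<Longrightarrow> l' < m \<Longrightarrow> v \<in> P l \<Longrightarrow> w \<in> P l' \<Longrightarrow> dist v w \<le> real J * \<rho>"
    and reg: "\<And>l z j. l < m \<Longrightarrow> z \<in> \<alpha> \<union> \<beta> \<Longrightarrow> j \<le> J \<Longrightarrow> card (P l \<inter> annulus \<rho> z j) \<le> b"
    and K: "K + 1 + m * b \<le> m * k"
  shows "isolated_part K (\<Union>l<m. P l) (\<Union>l<m. C l)"
proof -
  let ?P = "\<Union>l<m. P l" and ?C = "\<Union>l<m. C l"
  \<comment> \<open>Stated for an arbitrary centre with cell in
    \<open>\<alpha> \<union> \<beta>\<close>, so that it serves for the balls around both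
    endpoints.\<close>
  have crowd: "crowded K ?P x y"
    if x: "x \<in> ?P" and y: "y \<in> ?P" and gin: "g x \<in> \<alpha> \<union> \<beta>"
      and *: "\<And>l. l < m \<Longrightarrow> \<exists>x'\<in>P l. \<exists>y'\<in>P l. g x' = g x \<and> g y' = g y \<and> crowded k (P l) x' y'"
    for x y
  proof -
    let ?B = "\<lambda>l. {w \<in> P l. dist x w < dist x y}"
    have "k \<le> card (?B l) + b" if l: "l < m" for l
    proof -
      obtain x' y' where xy': "x' \<in> P l" "y' \<in> P l" "g x' = g x" "g y' = g y" "crowded k (P l) x' y'"
        using *[OF l] by blast
      have gx: "dist (g x) x \<le> \<rho>" "dist (g y) y \<le> \<rho>" using x y g by blast+
      have gx': "dist (g x) x' \<le> \<rho>" "dist (g y) y' \<le> \<rho>"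
        using g[OF l xy'(1)] g[OF l xy'(2)] xy' by auto
      show ?thesis
      proof (rule ball_card_transfer[where z = "g x" and x' = x' and y' = y' and \<rho> = \<rho>])
        obtain l1 l2 where "l1 < m" "x \<in> P l1" "l2 < m" "y \<in> P l2" using x y by blast
        then have "dist x y \<le> real J * \<rho>" using far[of l1 l2 x y] by simp
        then have "dist x y / \<rho> \<le> real J" using \<open>\<rho> > 0\<close> by (simp add: divide_simps)
        then have "nat \<lfloor>dist x y / \<rho>\<rfloor> - 1 \<le> J" by linarith
        then show "card (P l \<inter> annulus \<rho> (g x) (nat \<lfloor>dist x y / \<rho>\<rfloor> - 1)) \<le> b"
          using reg[OF l gin] by blast
        show "dist x' y' \<le> dist x y + 4 * \<rho>" using gx gx'
          by (smt (verit) dist_commute dist_triangle)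
      qed (use l fin xy' gx gx' \<open>\<rho> > 0\<close> in auto)
    qed
    then have "(\<Sum>l<m. k) \<le> (\<Sum>l<m. card (?B l) + b)" by (intro sum_mono) auto
    then have "m * k \<le> (\<Sum>l<m. card (?B l)) + m * b" by (simp add: sum.distrib)
    also have "(\<Sum>l<m. card (?B l)) = card (\<Union>l<m. ?B l)"
      using disj fin by (subst card_UN_disjoint) (auto simp: disjoint_family_on_def)
    finally have "K + 1 \<le> card (\<Union>l<m. ?B l)" using K by linarith
    \<comment> \<open>The sets \<open>?B l\<close> may contain \<open>x\<close> itself, which
      \<open>crowded\<close> leaves out; the \<open>+ 1\<close> in the hypothesis on
      \<open>K\<close> pays for it.\<close>
    also have "\<dots> \<le> card (insert x {w \<in> ?P - {x}. dist x w < dist x y})"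
      using fin by (intro card_mono) auto
    also have "\<dots> \<le> Suc (card {w \<in> ?P - {x}. dist x w < dist x y})"
      by (rule card_insert_le_m1) auto
    finally show ?thesis by (simp add: crowded_def)
  qed
  have "\<not> knn_adj K ?P x y" if x: "x \<in> ?C" and y: "y \<in> ?P - ?C" for x y
  proof -
    have CP: "C l \<subseteq> P l" if "l < m" for l using iso[OF that] by (simp add: isolated_part_def)
    have xP: "x \<in> ?P" using x CP by blast
    have gx: "g x \<in> \<alpha>" using x inner by blast
    have gy: "g y \<in> \<beta>" using y outer by blast
    \<comment> \<open>All parts have the cell pattern \<open>\<alpha>\<close> and all complements
      the pattern \<open>\<beta>\<close>, so the cells of \<open>x\<close> and \<open>y\<close> are
      met in every copy on the right side.\<close>
    have rep: "\<exists>x'\<in>P l. \<exists>y'\<in>P l. g x' = g x \<and> g y' = g y \<and> crowded k (P l) x' y' \<and> crowded k (P l) y' x'"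
      if l: "l < m" for l
    proof -
      obtain x' where x': "x' \<in> C l" "g x' = g x" using gx inner[OF l] by (metis imageE)
      obtain y' where y': "y' \<in> P l - C l" "g y' = g y" using gy outer[OF l] by (metis imageE)
      have "\<not> knn_adj k (P l) x' y'" using iso[OF l] x' y' by (auto simp: isolated_part_def)
      moreover have "x' \<in> P l" "x' \<noteq> y'" using x' y' CP[OF l] by auto
      ultimately show ?thesis using x' y' not_knn_adj_iff_crowded[of x' "P l" y'] by blast
    qed
    have "crowded K ?P x y" using y gx rep by (intro crowd[OF xP]) (simp, simp, metis)
    moreover have "crowded K ?P y x" using y gy rep by (intro crowd[OF _ xP]) (simp, simp, metis)
    moreover have "x \<noteq> y" using x y by (metis DiffE)
    moreover have "y \<in> ?P" using y by simp
    ultimately show ?thesis using not_knn_adj_iff_crowded[OF xP] by metis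
  qed
  moreover have "?C \<subseteq> ?P"
    using iso unfolding isolated_part_def by (meson UN_mono lessThan_iff subset_refl)
  moreover have "C 0 \<noteq> {}" using iso[OF \<open>m > 0\<close>] by (simp add: isolated_part_def)
  then have "?C \<noteq> {}" using \<open>m > 0\<close> by blast
  ultimately show ?thesis by (simp add: isolated_part_def)
qed

section \<open>Measurable events\<close>

interpretation lborel_pt: product_sigma_finite "\<lambda>_::nat. lborel :: pt measure"
  by (rule product_sigma_finite.intro) (rule sigma_finite_lborel)

abbreviation lborel_pow :: "nat set \<Rightarrow> (nat \<Rightarrow> pt) measure" where
  "lborel_pow I \<equiv> PiM I (\<lambda>_. lborel)"

text \<open>\<^const>\<open>measure\<close> is 0 on nonmeasurable sets, so lower bounds on \<^const>\<open>poisson_prob\<close> need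
  measurability of the event, including tuples \<open>x\<close> with coinciding entries, for which \<open>x ` I\<close> has fewer points.\<close>
definition measurable_event :: "(pt set \<Rightarrow> bool) \<Rightarrow> bool" where
  "measurable_event E \<longleftrightarrow> (\<forall>I. finite I \<longrightarrow> Measurable.pred (lborel_pow I) (\<lambda>x. E (x ` I)))"

text \<open>The event for a union of two independent processes. Disjointness of the pieces is
  demanded so that cardinalities add; it holds almost surely.\<close>

definition superpose :: "(pt set \<Rightarrow> bool) \<Rightarrow> (pt set \<Rightarrow> bool) \<Rightarrow> pt set \<Rightarrow> bool" where
  "superpose E F P \<longleftrightarrow> (\<exists>P1 P2. P = P1 \<union> P2 \<and> P1 \<inter> P2 = {} \<and> E P1 \<and> F P2)"

lemma coordinate_measurable:
  assumes "i \<in> I"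
  shows "(\<lambda>x. x i) \<in> borel_measurable (lborel_pow I)"
  using measurable_component_singleton[OF assms, of "\<lambda>_. lborel :: pt measure"] by simp

lemma pred_coordinate_in:
  assumes "i \<in> I" "T \<in> sets borel"
  shows "Measurable.pred (lborel_pow I) (\<lambda>x. x i \<in> T)"
  using coordinate_measurable[OF assms(1)] assms(2) by measurable

lemma pred_coordinates_eq:
  assumes "i \<in> I" "j \<in> I"
  shows "Measurable.pred (lborel_pow I) (\<lambda>x. x i = x j)"
proof -
  note [measurable] = coordinate_measurable[OF assms(1)] coordinate_measurable[OF assms(2)]
  have "Measurable.pred (lborel_pow I) (\<lambda>x. dist (x i) (x j) = 0)" by measurable
  then show ?thesis by simp
qed

text \<open>At least \<open>k\<close> values satisfy \<open>Q\<close> iff some \<open>k\<close>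
  indices carry pairwise distinct entries satisfying it, which is a finite combination of measurable
  conditions.\<close>

lemma pred_le_card_image:
  assumes fin: "finite I" and Q: "\<And>i. i \<in> I \<Longrightarrow> Measurable.pred (lborel_pow I) (\<lambda>x. Q x (x i))"
  shows "Measurable.pred (lborel_pow I) (\<lambda>x. k \<le> card {z \<in> x ` I. Q x z})"
proof -
  have "k \<le> card {z \<in> x ` I. Q x z} \<longleftrightarrow>
      (\<exists>J\<in>{J \<in> Pow I. card J = k}. (\<forall>i\<in>J. \<forall>j\<in>J. i \<noteq> j \<longrightarrow> x i \<noteq> x j) \<and> (\<forall>i\<in>J. Q x (x i)))"
    (is "?L \<longleftrightarrow> ?R") for x :: "nat \<Rightarrow> pt"
  proof
    assume ?L
    then obtain S where S: "S \<subseteq> {z \<in> x ` I. Q x z}" "card S = k" "finite S"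
      by (rule obtain_subset_with_card_n)
    then have "S \<subseteq> x ` I" by auto
    then obtain J where J: "J \<subseteq> I" "inj_on x J" "S = x ` J" by (metis subset_image_inj)
    with S have "card J = k" by (simp add: card_image)
    moreover have "\<forall>i\<in>J. Q x (x i)" using S(1) J(3) by blast
    ultimately show ?R using J by (auto simp: inj_on_def)
  next
    assume ?R
    then obtain J where J: "J \<subseteq> I" "card J = k" "inj_on x J" "\<forall>i\<in>J. Q x (x i)"
      by (auto simp: inj_on_def)
    then have "k = card (x ` J)" by (simp add: card_image)
    also have "\<dots> \<le> card {z \<in> x ` I. Q x z}"
      using J assms(1) by (intro card_mono) auto
    finally show ?L .
  qed
  moreover have "Measurable.pred (lborel_pow I)
      (\<lambda>x. \<exists>J\<in>{J \<in> Pow I. card J = k}. (\<forall>i\<in>J. \<forall>j\<in>J. i \<noteq> j \<longrightarrow> x i \<noteq> x j) \<and> (\<forall>i\<in>J. Q x (x i)))"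
    using assms
    by (intro pred_intros_finite pred_intros_logic pred_intros_imp' pred_coordinates_eq Q) (auto intro: finite_subset[OF _ fin])
  ultimately show ?thesis by simp
qed

lemma pred_crowded:
  assumes "finite I" "i \<in> I" "j \<in> I"
  shows "Measurable.pred (lborel_pow I) (\<lambda>x. crowded k (x ` I) (x i) (x j))"
proof -
  have "Measurable.pred (lborel_pow I)
      (\<lambda>x. k \<le> card {z \<in> x ` I. z \<noteq> x i \<and> dist (x i) z < dist (x i) (x j)})"
  proof (rule pred_le_card_image[OF assms(1)])
    fix l assume "l \<in> I"
    note [measurable] = coordinate_measurable[OF assms(2)] coordinate_measurable[OF assms(3)]
      coordinate_measurable[OF \<open>l \<in> I\<close>]
    have "Measurable.pred (lborel_pow I) (\<lambda>x. dist (x i) (x l) < dist (x i) (x j))"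
      by measurable
    then show "Measurable.pred (lborel_pow I) (\<lambda>x. x l \<noteq> x i \<and> dist (x i) (x l) < dist (x i) (x j))"
      by (intro pred_intros_logic(2,3) pred_coordinates_eq \<open>l \<in> I\<close> assms(2))
  qed
  moreover have "{z \<in> x ` I. z \<noteq> x i \<and> dist (x i) z < dist (x i) (x j)} =
      {z \<in> x ` I - {x i}. dist (x i) z < dist (x i) (x j)}" for x :: "nat \<Rightarrow> pt"
    by (simp only: Diff_iff singleton_iff conj_assoc not_False_eq_True)
  ultimately show ?thesis by (simp only: crowded_def)
qed

lemma measurable_event_card_le:
  assumes "T \<in> sets borel"
  shows "measurable_event (\<lambda>P. card (P \<inter> T) \<le> b)"
proof -
  have "Measurable.pred (lborel_pow I) (\<lambda>x. \<not> Suc b \<le> card {z \<in> x ` I. z \<in> T})"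
    if "finite I" for I
    by (rule pred_intros_logic(2), rule pred_le_card_image[OF that], rule pred_coordinate_in)
      (use assms in auto)
  moreover have "{z \<in> x ` I. z \<in> T} = x ` I \<inter> T" for x :: "nat \<Rightarrow> pt" and I by auto
  ultimately show ?thesis by (simp add: measurable_event_def not_less_eq_eq)
qed

lemma measurable_event_conj:
  "measurable_event E \<Longrightarrow> measurable_event F \<Longrightarrow> measurable_event (\<lambda>P. E P \<and> F P)"
  unfolding measurable_event_def by (intro allI impI pred_intros_logic(3)) simp_all

lemma measurable_event_disj:
  "measurable_event E \<Longrightarrow> measurable_event F \<Longrightarrow> measurable_event (\<lambda>P. E P \<or> F P)"
  unfolding measurable_event_def by (intro allI impI pred_intros_logic(5)) simp_all

lemma measurable_event_not:
  "measurable_event E \<Longrightarrow> measurable_event (\<lambda>P. \<not> E P)"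
  unfolding measurable_event_def by (intro allI impI pred_intros_logic(2)) simp_all

lemma measurable_event_ball:
  assumes "finite S" "\<And>s. s \<in> S \<Longrightarrow> measurable_event (E s)"
  shows "measurable_event (\<lambda>P. \<forall>s\<in>S. E s P)"
  using assms unfolding measurable_event_def by (intro allI impI pred_intros_finite) auto

lemma measurable_event_bex:
  assumes "finite S" "\<And>s. s \<in> S \<Longrightarrow> measurable_event (E s)"
  shows "measurable_event (\<lambda>P. \<exists>s\<in>S. E s P)"
  using assms unfolding measurable_event_def by (intro allI impI pred_intros_finite) auto

lemma pred_event_subset:
  assumes "measurable_event E" "finite I" "T \<subseteq> I"
  shows "Measurable.pred (lborel_pow I) (\<lambda>x. E (x ` T))"
proof -
  have "finite T" using assms finite_subset by blast
  then have "Measurable.pred (lborel_pow T) (\<lambda>x. E (x ` T))"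
    using assms by (simp add: measurable_event_def)
  then have "Measurable.pred (lborel_pow I) (\<lambda>x. E (restrict x T ` T))"
    using measurable_compose measurable_restrict_subset[OF assms(3)] by blast
  then show ?thesis by simp
qed

text \<open>Replaces a quantifier over sets of points by a finite one over sets of indices. The
  separation condition keeps coinciding entries on the same side, so that the complement of the
  image is the image of the complement.\<close>

lemma subset_of_image_iff:
  "(\<exists>C\<subseteq>x ` I. \<Phi> C (x ` I - C)) \<longleftrightarrow>
    (\<exists>T\<in>Pow I. (\<forall>i\<in>T. \<forall>j\<in>I - T. x i \<noteq> x j) \<and> \<Phi> (x ` T) (x ` (I - T)))"
proof
  assume "\<exists>C\<subseteq>x ` I. \<Phi> C (x ` I - C)"
  then obtain C where C: "C \<subseteq> x ` I" "\<Phi> C (x ` I - C)" by blast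
  define T where "T = {i \<in> I. x i \<in> C}"
  have "x ` T = C" "x ` (I - T) = x ` I - C" using C(1) by (auto simp: T_def)
  moreover have "\<forall>i\<in>T. \<forall>j\<in>I - T. x i \<noteq> x j" "T \<in> Pow I" by (auto simp: T_def)
  ultimately show "\<exists>T\<in>Pow I. (\<forall>i\<in>T. \<forall>j\<in>I - T. x i \<noteq> x j) \<and> \<Phi> (x ` T) (x ` (I - T))"
    using C(2) by metis
next
  assume "\<exists>T\<in>Pow I. (\<forall>i\<in>T. \<forall>j\<in>I - T. x i \<noteq> x j) \<and> \<Phi> (x ` T) (x ` (I - T))"
  then obtain T where T: "T \<subseteq> I" "\<forall>i\<in>T. \<forall>j\<in>I - T. x i \<noteq> x j" "\<Phi> (x ` T) (x ` (I - T))"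
    by blast
  have "x ` (I - T) = x ` I - x ` T" using T(1,2) by blast
  then have "\<Phi> (x ` T) (x ` I - x ` T)" using T(3) by simp
  moreover have "x ` T \<subseteq> x ` I" using T(1) by (rule image_mono)
  ultimately show "\<exists>C\<subseteq>x ` I. \<Phi> C (x ` I - C)" by (intro exI[of _ "x ` T"] conjI)
qed

lemma superpose_iff: "superpose E F P \<longleftrightarrow> (\<exists>C\<subseteq>P. E C \<and> F (P - C))"
proof
  assume "superpose E F P"
  then obtain P1 P2 where "P = P1 \<union> P2" "P1 \<inter> P2 = {}" "E P1" "F P2"
    by (auto simp: superpose_def)
  moreover from this have "P - P1 = P2" by (simp add: Un_Diff Diff_triv Int_commute)
  ultimately show "\<exists>C\<subseteq>P. E C \<and> F (P - C)" by (intro exI[of _ P1]) simp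
next
  assume "\<exists>C\<subseteq>P. E C \<and> F (P - C)"
  then obtain C where "C \<subseteq> P" "E C" "F (P - C)" by (elim exE conjE)
  moreover from this have "P = C \<union> (P - C)" "C \<inter> (P - C) = {}" by (simp_all add: Un_absorb1)
  ultimately show "superpose E F P"
    unfolding superpose_def by (intro exI[of _ C] exI[of _ "P - C"] conjI)
qed

lemma measurable_event_superpose:
  assumes "measurable_event E" "measurable_event F"
  shows "measurable_event (superpose E F)"
  unfolding measurable_event_def superpose_iff subset_of_image_iff[where \<Phi> = "\<lambda>C D. E C \<and> F D"]
proof (intro allI impI)
  fix I :: "nat set" assume fin: "finite I"
  then show "Measurable.pred (lborel_pow I) (\<lambda>x. \<exists>T\<in>Pow I. (\<forall>i\<in>T. \<forall>j\<in>I - T. x i \<noteq> x j)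
      \<and> E (x ` T) \<and> F (x ` (I - T)))"
    by (intro pred_intros_finite pred_intros_logic pred_coordinates_eq
        pred_event_subset[OF assms(1)] pred_event_subset[OF assms(2)]) (auto intro: finite_subset[OF _ fin])
qed

lemma image_eq_iff: "h ` T = A \<longleftrightarrow> (\<forall>i\<in>T. h i \<in> A) \<and> (\<forall>z\<in>A. \<exists>i\<in>T. h i = z)"
  by auto

lemma pred_image_eq:
  assumes "finite I" "T \<subseteq> I" and g: "g \<in> borel_measurable borel" and "finite \<alpha>"
  shows "Measurable.pred (lborel_pow I) (\<lambda>x. g ` x ` T = (\<alpha> :: pt set))"
proof -
  have eq: "g ` x ` T = \<alpha> \<longleftrightarrow> (\<forall>i\<in>T. x i \<in> g -` \<alpha>) \<and> (\<forall>z\<in>\<alpha>. \<exists>i\<in>T. x i \<in> g -` {z})"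
    for x :: "nat \<Rightarrow> pt"
    using image_eq_iff[of "\<lambda>i. g (x i)" T \<alpha>] by (simp only: image_image vimage_eq singleton_iff)
  have fibre: "g -` S \<in> sets borel" if "finite S" for S :: "pt set"
    using measurable_sets[OF g, of S] that by (simp add: finite_imp_closed)
  have "finite T" using assms finite_subset by blast
  then show ?thesis
    unfolding eq using assms
    by (intro pred_intros_finite pred_intros_logic(3) pred_coordinate_in fibre) auto
qed

text \<open>\<open>\<alpha>\<close> and \<open>\<beta>\<close> record the cells met by the part and
  by its complement; a cell may belong to both.\<close>

definition patterned_isolated_part ::
  "nat \<Rightarrow> pt set \<Rightarrow> (pt \<Rightarrow> pt) \<Rightarrow> pt set \<Rightarrow> pt set \<Rightarrow> pt set \<Rightarrow> bool" where
  "patterned_isolated_part k V g \<alpha> \<beta> P \<longleftrightarrow>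
     (\<exists>C. isolated_part k P C \<and> C \<subseteq> V \<and> g ` C = \<alpha> \<and> g ` (P - C) = \<beta>)"

lemma measurable_event_patterned_isolated_part:
  assumes "V \<in> sets borel" "g \<in> borel_measurable borel" "finite \<alpha>" "finite \<beta>"
  shows "measurable_event (patterned_isolated_part k V g \<alpha> \<beta>)"
proof -
  \<comment> \<open>The whole configuration is written as \<open>P \<union> Q\<close>, so that the
    condition depends only on the part and its complement, the form that
    \<open>subset_of_image_iff\<close> handles.\<close>
  let ?Q = "\<lambda>P Q. P \<noteq> {} \<and> (\<forall>x\<in>P. \<forall>y\<in>Q. crowded k (P \<union> Q) x y \<and> crowded k (P \<union> Q) y x)
      \<and> P \<subseteq> V \<and> g ` P = \<alpha> \<and> g ` Q = \<beta>"
  have "patterned_isolated_part k V g \<alpha> \<beta> P \<longleftrightarrow> (\<exists>C\<subseteq>P. ?Q C (P - C))" for P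
  proof -
    have "(\<forall>x\<in>C. \<forall>y\<in>P - C. \<not> knn_adj k P x y) \<longleftrightarrow>
        (\<forall>x\<in>C. \<forall>y\<in>P - C. crowded k P x y \<and> crowded k P y x)" if "C \<subseteq> P" for C
    proof (intro ball_cong refl)
      fix x y assume "x \<in> C" "y \<in> P - C"
      then have "x \<in> P" "y \<in> P" "x \<noteq> y" using that by auto
      then show "\<not> knn_adj k P x y \<longleftrightarrow> crowded k P x y \<and> crowded k P y x"
        by (rule not_knn_adj_iff_crowded)
    qed
    then show ?thesis
      unfolding patterned_isolated_part_def isolated_part_def
      by (intro ex_cong1) (simp add: Un_absorb1 conj_ac cong: conj_cong)
  qed
  then have eq: "patterned_isolated_part k V g \<alpha> \<beta> = (\<lambda>P. \<exists>C\<subseteq>P. ?Q C (P - C))" by (rule ext)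
  show ?thesis
    unfolding measurable_event_def eq subset_of_image_iff[where \<Phi> = ?Q]
  proof (intro allI impI)
    fix I :: "nat set" assume fin: "finite I"
    show "Measurable.pred (lborel_pow I)
       (\<lambda>x. \<exists>T\<in>Pow I. (\<forall>i\<in>T. \<forall>j\<in>I - T. x i \<noteq> x j) \<and> ?Q (x ` T) (x ` (I - T)))"
    proof (rule pred_intros_finite(4))
      fix T assume T: "T \<in> Pow I"
      then have U: "x ` T \<union> x ` (I - T) = x ` I" for x :: "nat \<Rightarrow> pt"
        by (metis PowD Un_Diff_cancel Un_absorb1 image_Un)
      show "Measurable.pred (lborel_pow I)
         (\<lambda>x. (\<forall>i\<in>T. \<forall>j\<in>I - T. x i \<noteq> x j) \<and> ?Q (x ` T) (x ` (I - T)))"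
        unfolding U ball_simps(9) image_is_empty image_subset_iff
        using fin T assms
        by (intro pred_intros_finite pred_intros_logic pred_coordinates_eq pred_crowded
           pred_coordinate_in pred_image_eq) (auto intro: finite_subset[OF _ fin])
    qed (use fin in simp)
  qed
qed

text \<open>By Fubini: once the other entries are fixed, \<open>x i = x j\<close> confines
  \<open>x i\<close> to a single point, a null set.\<close>

lemma AE_inj_on:
  assumes "finite I"
  shows "AE x in lborel_pow I. inj_on x I"
proof -
  have "AE x in lborel_pow I. x i \<noteq> x j" if ij: "i \<in> I" "j \<in> I" "i \<noteq> j" for i j
  proof -
    define I' where "I' = I - {i}"
    have I: "I = insert i I'" "finite I'" "i \<notin> I'" "j \<in> I'" using ij assms by (auto simp: I'_def)
    let ?f = "\<lambda>x. indicator {x. x i = x j} x :: ennreal"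
    have f: "?f \<in> borel_measurable (lborel_pow I)"
      using pred_coordinates_eq[OF ij(1,2)]
      by (simp add: borel_measurable_indicator_iff pred_def Collect_conj_eq Int_commute)
    have "(\<integral>\<^sup>+ x. ?f x \<partial>lborel_pow I) = (\<integral>\<^sup>+ x. (\<integral>\<^sup>+ y. ?f (x(i := y)) \<partial>lborel) \<partial>lborel_pow I')"
      unfolding I(1) using f I by (intro lborel_pt.product_nn_integral_insert) auto
    also have "\<dots> = (\<integral>\<^sup>+ x. (\<integral>\<^sup>+ y. indicator {x j} y \<partial>lborel) \<partial>lborel_pow I')"
      using ij by (intro nn_integral_cong) (auto simp: indicator_def)
    also have "\<dots> = 0" by simp
    finally have "AE x in lborel_pow I. ?f x = 0"
      using f by (simp add: nn_integral_0_iff_AE)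
    then show ?thesis by eventually_elim (auto simp: indicator_def)
  qed
  then have "AE x in lborel_pow I. \<forall>i\<in>I. \<forall>j\<in>I. i \<noteq> j \<longrightarrow> x i \<noteq> x j"
    using assms by (intro AE_finite_allI) auto
  then show ?thesis by eventually_elim (auto simp: inj_on_def)
qed

section \<open>Configuration volumes\<close>

text \<open>A product measure is determined by its values on boxes, where reindexing only permutes
  the factors.\<close>

lemma distr_lborel_pow_reindex:
  assumes "bij_betw h I J" "finite I"
  shows "distr (lborel_pow J) (lborel_pow I) (\<lambda>x. \<lambda>i\<in>I. x (h i)) = lborel_pow I"
proof (rule lborel_pt.PiM_eqI)
  have fin: "finite J" using assms bij_betw_finite by blast
  have hJ: "h i \<in> J" if "i \<in> I" for i using assms that bij_betwE by blast
  let ?T = "\<lambda>x. \<lambda>i\<in>I. x (h i)"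
  have T: "?T \<in> lborel_pow J \<rightarrow>\<^sub>M lborel_pow I"
    by (intro measurable_restrict measurable_component_singleton hJ)
  fix A :: "nat \<Rightarrow> pt set" assume A: "\<And>i. i \<in> I \<Longrightarrow> A i \<in> sets lborel"
  have Ah: "A (the_inv_into I h j) \<in> sets lborel" if "j \<in> J" for j
    using A that assms(1) by (metis bij_betw_def the_inv_into_into order_refl)
  have inv: "the_inv_into I h (h i) = i" if "i \<in> I" for i
    using that assms(1) by (simp add: bij_betw_def the_inv_into_f_f)
  have "?T -` Pi\<^sub>E I A \<inter> space (lborel_pow J) = Pi\<^sub>E J (\<lambda>j. A (the_inv_into I h j))" (is "?L = ?R")
  proof (rule set_eqI)
    fix x :: "nat \<Rightarrow> pt"
    have "(\<forall>i\<in>I. x (h i) \<in> A i) \<longleftrightarrow> (\<forall>i\<in>I. x (h i) \<in> A (the_inv_into I h (h i)))"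
      using inv by simp
    also have "\<dots> \<longleftrightarrow> (\<forall>j\<in>h ` I. x j \<in> A (the_inv_into I h j))" by simp
    also have "h ` I = J" using assms(1) by (simp add: bij_betw_def)
    finally show "x \<in> ?L \<longleftrightarrow> x \<in> ?R"
      by (simp add: space_PiM PiE_iff)
  qed
  then have "emeasure (distr (lborel_pow J) (lborel_pow I) ?T) (Pi\<^sub>E I A)
      = emeasure (lborel_pow J) (Pi\<^sub>E J (\<lambda>j. A (the_inv_into I h j)))"
    using T A assms(2) by (subst emeasure_distr) (auto intro!: sets_PiM_I_finite)
  also have "\<dots> = (\<Prod>j\<in>J. emeasure lborel (A (the_inv_into I h j)))"
    using Ah fin by (intro lborel_pt.emeasure_PiM) auto
  also have "\<dots> = (\<Prod>i\<in>I. emeasure lborel (A i))"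
    using prod.reindex_bij_betw[OF assms(1), of "\<lambda>j. emeasure lborel (A (the_inv_into I h j))"] inv
    by simp
  finally show "emeasure (distr (lborel_pow J) (lborel_pow I) ?T) (Pi\<^sub>E I A)
    = (\<Prod>i\<in>I. emeasure lborel (A i))" .
qed (use assms in auto)

lemma emeasure_lborel_vimage_scaleR:
  fixes B :: "'a::euclidean_space set"
  assumes "s > 0" "B \<in> sets borel"
  shows "ennreal (s ^ DIM('a)) * emeasure lborel ((*\<^sub>R) s -` B) = emeasure lborel B"
proof -
  have "emeasure lborel B = emeasure (density (distr lborel borel (\<lambda>x. 0 + s *\<^sub>R x)) (\<lambda>_. \<bar>s\<bar> ^ DIM('a))) B"
    using lborel_affine[of s "0::'a"] assms(1) by simp
  also have "\<dots> = ennreal (s ^ DIM('a)) * emeasure (distr lborel borel ((*\<^sub>R) s)) B"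
    using assms by (subst emeasure_density) (simp_all add: nn_integral_cmult_indicator)
  also have "emeasure (distr lborel borel ((*\<^sub>R) s)) B = emeasure lborel ((*\<^sub>R) s -` B)"
    using assms by (subst emeasure_distr) auto
  finally show ?thesis by simp
qed

text \<open>Each of the \<open>card I\<close> planar coordinates contributes a factor
  \<open>s\<^sup>2\<close>.\<close>

lemma lborel_pow_scaleR:
  assumes "s > 0" "finite I"
  shows "scale_measure (ennreal (s\<^sup>2 ^ card I))
    (distr (lborel_pow I) (lborel_pow I) (\<lambda>x. \<lambda>i\<in>I. s *\<^sub>R x i)) = lborel_pow I"
proof (rule lborel_pt.PiM_eqI)
  let ?T = "\<lambda>x. \<lambda>i\<in>I. s *\<^sub>R x i"
  have T: "?T \<in> lborel_pow I \<rightarrow>\<^sub>M lborel_pow I"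
  proof (rule measurable_restrict)
    fix i assume "i \<in> I"
    note [measurable] = coordinate_measurable[OF this]
    show "(\<lambda>x. s *\<^sub>R x i) \<in> lborel_pow I \<rightarrow>\<^sub>M lborel" by measurable
  qed
  fix A :: "nat \<Rightarrow> pt set" assume A: "\<And>i. i \<in> I \<Longrightarrow> A i \<in> sets lborel"
  have vA: "(*\<^sub>R) s -` A i \<in> sets lborel" if "i \<in> I" for i
  proof -
    have "(*\<^sub>R) s \<in> borel_measurable (borel :: pt measure)" by measurable
    from measurable_sets[OF this, of "A i"] A[OF that] show ?thesis by simp
  qed
  have "?T -` Pi\<^sub>E I A \<inter> space (lborel_pow I) = Pi\<^sub>E I (\<lambda>i. (*\<^sub>R) s -` A i)"
    by (rule set_eqI) (simp add: space_PiM PiE_iff)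
  then have "emeasure (distr (lborel_pow I) (lborel_pow I) ?T) (Pi\<^sub>E I A)
      = emeasure (lborel_pow I) (Pi\<^sub>E I (\<lambda>i. (*\<^sub>R) s -` A i))"
    using T A assms(2) by (subst emeasure_distr) (auto intro!: sets_PiM_I_finite)
  also have "\<dots> = (\<Prod>i\<in>I. emeasure lborel ((*\<^sub>R) s -` A i))"
    using vA assms by (intro lborel_pt.emeasure_PiM) auto
  finally have "ennreal (s\<^sup>2 ^ card I) * emeasure (distr (lborel_pow I) (lborel_pow I) ?T) (Pi\<^sub>E I A)
      = (\<Prod>i\<in>I. ennreal (s\<^sup>2) * emeasure lborel ((*\<^sub>R) s -` A i))"
    by (simp add: prod.distrib ennreal_power)
  also have "\<dots> = (\<Prod>i\<in>I. emeasure lborel (A i))"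
    using emeasure_lborel_vimage_scaleR[OF assms(1), where 'a = pt] A
    by (intro prod.cong refl) (simp add: power2_eq_square)
  finally show "emeasure (scale_measure (ennreal (s\<^sup>2 ^ card I))
    (distr (lborel_pow I) (lborel_pow I) ?T)) (Pi\<^sub>E I A) = (\<Prod>i\<in>I. emeasure lborel (A i))"
    by simp
qed (use assms in auto)

text \<open>Not divided by a power of the area: that power cancels against the one in the Poisson
  weight, so it never has to appear.\<close>

definition config_vol :: "pt set \<Rightarrow> nat set \<Rightarrow> (pt set \<Rightarrow> bool) \<Rightarrow> real" where
  "config_vol U I E = measure (lborel_pow I) {x \<in> I \<rightarrow>\<^sub>E U. E (x ` I)}"

text \<open>The probability of \<open>E\<close> for a Poisson process of intensity
  \<open>\<mu>\<close> in \<open>U\<close>, in the same representation by configuration volumes as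
  \<open>poisson_prob\<close>.\<close>

definition poisson_window :: "pt set \<Rightarrow> real \<Rightarrow> (pt set \<Rightarrow> bool) \<Rightarrow> real" where
  "poisson_window U \<mu> E =
     exp (- \<mu> * measure lborel U) * (\<Sum>n. \<mu> ^ n / fact n * config_vol U {..<n} E)"

locale window =
  fixes U :: "pt set"
  assumes U_borel: "U \<in> sets borel" and U_bounded: "bounded U"
begin

abbreviation "area \<equiv> measure lborel U"

lemma emeasure_U: "emeasure lborel U = ennreal area"
  using emeasure_bounded_finite[OF U_bounded] by (simp add: emeasure_eq_ennreal_measure)

lemma config_sets:
  assumes "finite I" "measurable_event E"
  shows "{x \<in> I \<rightarrow>\<^sub>E U. E (x ` I)} \<in> sets (lborel_pow I)"
proof -
  have "{x \<in> space (lborel_pow I). E (x ` I)} \<in> sets (lborel_pow I)"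
    using assms by (simp add: measurable_event_def pred_def)
  moreover have "(I \<rightarrow>\<^sub>E U) \<in> sets (lborel_pow I)"
    using assms U_borel by (intro sets_PiM_I_finite) auto
  ultimately have "{x \<in> space (lborel_pow I). E (x ` I)} \<inter> (I \<rightarrow>\<^sub>E U) \<in> sets (lborel_pow I)"
    by blast
  moreover have "{x \<in> space (lborel_pow I). E (x ` I)} \<inter> (I \<rightarrow>\<^sub>E U) = {x \<in> I \<rightarrow>\<^sub>E U. E (x ` I)}"
    by (auto simp: space_PiM PiE_def)
  ultimately show ?thesis by simp
qed

lemma emeasure_PiE_U: "finite I \<Longrightarrow> emeasure (lborel_pow I) (I \<rightarrow>\<^sub>E U) = ennreal (area ^ card I)"
  using U_borel by (simp add: lborel_pt.emeasure_PiM emeasure_U ennreal_power)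

lemma emeasure_config_le:
  assumes "finite I"
  shows "emeasure (lborel_pow I) {x \<in> I \<rightarrow>\<^sub>E U. E (x ` I)} \<le> ennreal (area ^ card I)"
proof -
  have "emeasure (lborel_pow I) {x \<in> I \<rightarrow>\<^sub>E U. E (x ` I)} \<le> emeasure (lborel_pow I) (I \<rightarrow>\<^sub>E U)"
    using assms U_borel by (intro emeasure_mono sets_PiM_I_finite) auto
  then show ?thesis using emeasure_PiE_U[OF assms] by simp
qed

lemma emeasure_config:
  assumes "finite I"
  shows "emeasure (lborel_pow I) {x \<in> I \<rightarrow>\<^sub>E U. E (x ` I)} = ennreal (config_vol U I E)"
  unfolding config_vol_def
  using emeasure_config_le[OF assms, of E] by (intro emeasure_eq_ennreal_measure) (auto simp: top_unique)

lemma config_vol_nonneg: "0 \<le> config_vol U I E"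
  by (simp add: config_vol_def)

lemma config_vol_le:
  assumes "finite I"
  shows "config_vol U I E \<le> area ^ card I"
  using emeasure_config_le[OF assms, of E] emeasure_config[OF assms, of E]
  by (simp add: config_vol_nonneg ennreal_le_iff)

text \<open>Tuples with coinciding entries form a null set, so the implication may be checked on
  injective tuples, where the image has exactly \<open>card I\<close> points.\<close>

lemma config_vol_mono_AE:
  assumes "finite I" "measurable_event F"
    and "\<And>x. x \<in> I \<rightarrow>\<^sub>E U \<Longrightarrow> inj_on x I \<Longrightarrow> E (x ` I) \<Longrightarrow> F (x ` I)"
  shows "config_vol U I E \<le> config_vol U I F"
proof -
  have "AE x in lborel_pow I. x \<in> {x \<in> I \<rightarrow>\<^sub>E U. E (x ` I)} \<longrightarrow> x \<in> {x \<in> I \<rightarrow>\<^sub>E U. F (x ` I)}"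
    using AE_inj_on[OF assms(1)] by eventually_elim (use assms(3) in auto)
  then have "emeasure (lborel_pow I) {x \<in> I \<rightarrow>\<^sub>E U. E (x ` I)}
      \<le> emeasure (lborel_pow I) {x \<in> I \<rightarrow>\<^sub>E U. F (x ` I)}"
    using config_sets assms by (intro emeasure_mono_AE) auto
  then show ?thesis
    using assms by (simp add: emeasure_config config_vol_nonneg ennreal_le_iff)
qed

lemma config_vol_disj:
  assumes "finite I" "measurable_event E" "measurable_event F"
  shows "config_vol U I (\<lambda>P. E P \<or> F P) \<le> config_vol U I E + config_vol U I F"
proof -
  have "{x \<in> I \<rightarrow>\<^sub>E U. E (x ` I) \<or> F (x ` I)} = {x \<in> I \<rightarrow>\<^sub>E U. E (x ` I)} \<union> {x \<in> I \<rightarrow>\<^sub>E U. F (x ` I)}"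
    by auto
  then have "emeasure (lborel_pow I) {x \<in> I \<rightarrow>\<^sub>E U. E (x ` I) \<or> F (x ` I)}
      \<le> emeasure (lborel_pow I) {x \<in> I \<rightarrow>\<^sub>E U. E (x ` I)} + emeasure (lborel_pow I) {x \<in> I \<rightarrow>\<^sub>E U. F (x ` I)}"
    using emeasure_subadditive[OF config_sets[OF assms(1,2)] config_sets[OF assms(1,3)]] by simp
  then show ?thesis
    unfolding emeasure_config[OF assms(1)] emeasure_config[OF assms(1), of "\<lambda>P. E P \<or> F P"]
    by (simp add: config_vol_nonneg ennreal_le_iff flip: ennreal_plus)
qed

lemma config_vol_reindex:
  assumes "bij_betw h I J" "finite I" "measurable_event E"
  shows "config_vol U J E = config_vol U I E"
proof -
  let ?T = "\<lambda>x. \<lambda>i\<in>I. x (h i)"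
  have hJ: "h i \<in> J" if "i \<in> I" for i using assms that bij_betwE by blast
  have hI: "h ` I = J" using assms(1) by (simp add: bij_betw_def)
  have T: "?T \<in> lborel_pow J \<rightarrow>\<^sub>M lborel_pow I"
    by (intro measurable_restrict measurable_component_singleton hJ)
  have "?T -` {x \<in> I \<rightarrow>\<^sub>E U. E (x ` I)} \<inter> space (lborel_pow J) = {x \<in> J \<rightarrow>\<^sub>E U. E (x ` J)}" (is "?L = ?R")
  proof (rule set_eqI)
    fix x :: "nat \<Rightarrow> pt"
    have "?T x ` I = x ` J" using hI by (simp add: image_image[symmetric])
    moreover have "(\<forall>i\<in>I. x (h i) \<in> U) \<longleftrightarrow> (\<forall>j\<in>J. x j \<in> U)" using hI by blast
    ultimately show "x \<in> ?L \<longleftrightarrow> x \<in> ?R" by (simp add: space_PiM PiE_iff conj_ac)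
  qed
  then have "measure (distr (lborel_pow J) (lborel_pow I) ?T) {x \<in> I \<rightarrow>\<^sub>E U. E (x ` I)} = config_vol U J E"
    using T config_sets[OF assms(2,3)] by (subst measure_distr) (simp_all add: config_vol_def)
  then show ?thesis
    using distr_lborel_pow_reindex[OF assms(1,2)] by (simp add: config_vol_def)
qed

text \<open>By Fubini the left side is the volume of a product set. Merging tuples maps it into the
  superposed event, except where entries of the two tuples coincide, which happens only on a null
  set.\<close>

lemma config_vol_superpose:
  assumes "finite I" "finite J" "I \<inter> J = {}" and E: "measurable_event E" and F: "measurable_event F"
  shows "config_vol U I E * config_vol U J F \<le> config_vol U (I \<union> J) (superpose E F)"
proof -
  let ?M = "lborel_pow (I \<union> J)"
  let ?S = "{x \<in> I \<union> J \<rightarrow>\<^sub>E U. superpose E F (x ` (I \<union> J))}"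
  let ?SI = "{x \<in> I \<rightarrow>\<^sub>E U. E (x ` I)}" and ?SJ = "{x \<in> J \<rightarrow>\<^sub>E U. F (x ` J)}"
  interpret J: sigma_finite_measure "lborel_pow J"
    by (rule lborel_pt.sigma_finite[OF assms(2)])
  have S: "?S \<in> sets ?M"
    using assms by (intro config_sets measurable_event_superpose) auto
  have merge: "merge I J \<in> lborel_pow I \<Otimes>\<^sub>M lborel_pow J \<rightarrow>\<^sub>M ?M" by (rule measurable_merge)
  let ?N = "{x \<in> space ?M. \<not> inj_on x (I \<union> J)}"
  have "AE x in ?M. inj_on x (I \<union> J)" using assms by (intro AE_inj_on) auto
  then obtain N where N: "?N \<subseteq> N" "emeasure ?M N = 0" "N \<in> sets ?M"
    by (rule AE_E) 
  have sub: "?SI \<times> ?SJ \<subseteq> merge I J -` (?S \<union> N) \<inter> space (lborel_pow I \<Otimes>\<^sub>M lborel_pow J)"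
  proof (rule subsetI)
    fix p assume "p \<in> ?SI \<times> ?SJ"
    then obtain x y where p: "p = (x, y)" "x \<in> ?SI" "y \<in> ?SJ" by blast
    let ?z = "merge I J (x, y)"
    have zI: "?z ` I = x ` I" by (intro image_cong) (auto simp: merge_def)
    have zJ: "?z ` J = y ` J" using assms(3) by (intro image_cong) (auto simp: merge_def)
    have zU: "?z \<in> I \<union> J \<rightarrow>\<^sub>E U" using p assms(3) by (auto simp: PiE_iff)
    have "?z \<in> ?S" if "inj_on ?z (I \<union> J)"
    proof -
      have "?z ` I \<inter> ?z ` J = {}"
        using that assms(3) inj_on_image_Int[OF that, of I J] by auto
      then have "superpose E F (?z ` I \<union> ?z ` J)"
        using p zI zJ unfolding superpose_def by (intro exI[of _ "?z ` I"] exI[of _ "?z ` J"]) simp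
      then show ?thesis using zU by (simp add: image_Un)
    qed
    moreover have "?z \<in> space ?M" using zU by (auto simp: space_PiM PiE_iff)
    moreover have "p \<in> space (lborel_pow I \<Otimes>\<^sub>M lborel_pow J)"
      using p by (auto simp: space_pair_measure space_PiM PiE_iff)
    ultimately show "p \<in> merge I J -` (?S \<union> N) \<inter> space (lborel_pow I \<Otimes>\<^sub>M lborel_pow J)"
      using N(1) p(1) by auto
  qed
  have "emeasure (lborel_pow I) ?SI * emeasure (lborel_pow J) ?SJ
      = emeasure (lborel_pow I \<Otimes>\<^sub>M lborel_pow J) (?SI \<times> ?SJ)"
    using config_sets[OF assms(1) E] config_sets[OF assms(2) F] by (simp add: J.emeasure_pair_measure_Times)
  also have "\<dots> \<le> emeasure (lborel_pow I \<Otimes>\<^sub>M lborel_pow J)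
      (merge I J -` (?S \<union> N) \<inter> space (lborel_pow I \<Otimes>\<^sub>M lborel_pow J))"
    using S N(3) merge sub by (intro emeasure_mono measurable_sets[OF merge]) auto
  also have "\<dots> = emeasure (distr (lborel_pow I \<Otimes>\<^sub>M lborel_pow J) ?M (merge I J)) (?S \<union> N)"
    using S N(3) merge by (subst emeasure_distr) auto
  also have "\<dots> = emeasure ?M (?S \<union> N)"
    using lborel_pt.distr_merge[OF assms(3,1,2)] by simp
  also have "\<dots> \<le> emeasure ?M ?S + emeasure ?M N"
    using S N(3) by (rule emeasure_subadditive)
  finally have "emeasure (lborel_pow I) ?SI * emeasure (lborel_pow J) ?SJ \<le> emeasure ?M ?S"
    using N(2) by simp
  then show ?thesis
    using assms(1,2) emeasure_config[of "I \<union> J" "superpose E F"]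
    by (simp add: emeasure_config config_vol_nonneg ennreal_le_iff flip: ennreal_mult)
qed

text \<open>Exponential Markov inequality: the indicator of the event is at most
  \<open>exp (- t * real b)\<close> times a product over the points, and the integral of that
  product factorises.\<close>

lemma config_vol_count_gt:
  assumes "finite I" "T \<in> sets borel" "t \<ge> 0"
  shows "config_vol U I (\<lambda>P. \<not> card (P \<inter> T) \<le> b)
    \<le> exp (- t * real b) * (area + (exp t - 1) * measure lborel (U \<inter> T)) ^ card I"
proof -
  let ?S = "{x \<in> I \<rightarrow>\<^sub>E U. \<not> card (x ` I \<inter> T) \<le> b}"
  \<comment> \<open>This weight is \<open>exp t\<close> on \<open>U \<inter> T\<close>, 1 on the
    rest of \<open>U\<close> and 0 outside \<open>U\<close>.\<close>
  let ?f = "\<lambda>w. indicator U w + ennreal (exp t - 1) * indicator (U \<inter> T) w :: ennreal"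
  have e: "exp t - 1 \<ge> 0" using assms(3) by simp
  have S: "?S \<in> sets (lborel_pow I)"
    using assms by (intro config_sets measurable_event_not measurable_event_card_le)
  have fin: "emeasure lborel (U \<inter> T) = ennreal (measure lborel (U \<inter> T))"
    using emeasure_bounded_finite[OF bounded_subset[OF U_bounded, of "U \<inter> T"]]
    by (simp add: emeasure_eq_ennreal_measure)
  have f: "?f \<in> borel_measurable lborel" using U_borel assms by measurable
  define B where "B = area + (exp t - 1) * measure lborel (U \<inter> T)"
  have B: "0 \<le> B" using e by (simp add: B_def)
  have int: "(\<integral>\<^sup>+ w. ?f w \<partial>lborel) = ennreal B"
    unfolding B_def using U_borel assms e
    by (simp add: nn_integral_add nn_integral_cmult_indicator fin emeasure_U ennreal_mult ennreal_plus)
  have le: "indicator ?S x \<le> ennreal (exp (- t * real b)) * (\<Prod>i\<in>I. ?f (x i))" for x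
  proof (cases "x \<in> ?S")
    case True
    let ?c = "card {i \<in> I. x i \<in> T}"
    have xU: "x i \<in> U" if "i \<in> I" for i using True that by auto
    have "x ` I \<inter> T = x ` {i \<in> I. x i \<in> T}" by blast
    \<comment> \<open>Coinciding entries make the image smaller than the index set, which is
      harmless in this direction.\<close>
    then have "card (x ` I \<inter> T) \<le> ?c" using assms(1) by (simp add: card_image_le)
    with True have bc: "b \<le> ?c" by simp
    have "?f (x i) = ennreal (exp (t * (if x i \<in> T then 1 else 0)))" if "i \<in> I" for i
      using xU[OF that] e ennreal_plus[of 1 "exp t - 1"] by (simp add: indicator_def)
    then have "(\<Prod>i\<in>I. ?f (x i)) = (\<Prod>i\<in>I. ennreal (exp (t * (if x i \<in> T then 1 else 0))))"
      by (intro prod.cong) auto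
    also have "\<dots> = ennreal (\<Prod>i\<in>I. exp (t * (if x i \<in> T then 1 else 0)))"
      by (simp add: prod_ennreal)
    also have "(\<Prod>i\<in>I. exp (t * (if x i \<in> T then 1 else 0))) = exp (t * real ?c)"
      using assms(1) by (simp add: exp_sum[symmetric] sum_distrib_left[symmetric] sum.If_cases Int_def)
    finally have "ennreal (exp (- t * real b)) * (\<Prod>i\<in>I. ?f (x i)) = ennreal (exp (t * (real ?c - real b)))"
      by (simp add: ennreal_mult[symmetric] exp_add[symmetric] algebra_simps)
    moreover have "1 \<le> exp (t * (real ?c - real b))" using bc assms(3) by simp
    ultimately show ?thesis using True by (simp add: indicator_def)
  next
    case False
    then have "indicator ?S x = (0 :: ennreal)" by (rule indicator_simps(2))
    then show ?thesis by (metis zero_le)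
  qed
  have "emeasure (lborel_pow I) ?S = (\<integral>\<^sup>+ x. indicator ?S x \<partial>lborel_pow I)"
    using S by simp
  also have "\<dots> \<le> (\<integral>\<^sup>+ x. ennreal (exp (- t * real b)) * (\<Prod>i\<in>I. ?f (x i)) \<partial>lborel_pow I)"
    by (intro nn_integral_mono le)
  also have "\<dots> = ennreal (exp (- t * real b)) * (\<integral>\<^sup>+ x. (\<Prod>i\<in>I. ?f (x i)) \<partial>lborel_pow I)"
  proof (rule nn_integral_cmult)
    show "(\<lambda>x. \<Prod>i\<in>I. ?f (x i)) \<in> borel_measurable (lborel_pow I)"
    proof (rule borel_measurable_prod_ennreal)
      fix i assume "i \<in> I"
      then have "(\<lambda>x. x i) \<in> lborel_pow I \<rightarrow>\<^sub>M lborel" by (rule measurable_component_singleton)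
      from measurable_compose[OF this f] show "(\<lambda>x. ?f (x i)) \<in> borel_measurable (lborel_pow I)" .
    qed
  qed
  also have "(\<integral>\<^sup>+ x. (\<Prod>i\<in>I. ?f (x i)) \<partial>lborel_pow I) = (\<Prod>i\<in>I. \<integral>\<^sup>+ w. ?f w \<partial>lborel)"
    using assms(1) f by (intro lborel_pt.product_nn_integral_prod) auto
  also have "ennreal (exp (- t * real b)) * (\<Prod>i\<in>I. \<integral>\<^sup>+ w. ?f w \<partial>lborel)
      = ennreal (exp (- t * real b) * B ^ card I)"
    unfolding int using B by (simp add: ennreal_mult ennreal_power)
  finally show ?thesis
    using B unfolding B_def[symmetric] emeasure_config[OF assms(1), of "\<lambda>P. \<not> card (P \<inter> T) \<le> b"] by (simp add: ennreal_le_iff)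
qed

end

section \<open>Poisson probabilities\<close>

context window
begin

lemma poisson_term_le:
  assumes "\<mu> \<ge> 0"
  shows "\<mu> ^ n / fact n * config_vol U {..<n} E \<le> inverse (fact n) * (\<mu> * area) ^ n"
  using mult_left_mono[OF config_vol_le[of "{..<n}" E], of "\<mu> ^ n / fact n"] assms
  by (simp add: power_mult_distrib field_simps)

lemma poisson_term_nonneg: "\<mu> \<ge> 0 \<Longrightarrow> 0 \<le> \<mu> ^ n / fact n * config_vol U {..<n} E"
  by (simp add: config_vol_nonneg)

lemma summable_poisson:
  assumes "\<mu> \<ge> 0"
  shows "summable (\<lambda>n. \<mu> ^ n / fact n * config_vol U {..<n} E)"
proof (rule summable_comparison_test'[OF summable_exp])
  fix n show "norm (\<mu> ^ n / fact n * config_vol U {..<n} E) \<le> inverse (fact n) * (\<mu> * area) ^ n"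
    using poisson_term_le[OF assms, of n E] poisson_term_nonneg[OF assms, of n E] by simp
qed

lemma poisson_window_nonneg: "\<mu> \<ge> 0 \<Longrightarrow> 0 \<le> poisson_window U \<mu> E"
  unfolding poisson_window_def
  by (intro mult_nonneg_nonneg suminf_nonneg summable_poisson poisson_term_nonneg) auto

lemma poisson_window_le_1:
  assumes "\<mu> \<ge> 0"
  shows "poisson_window U \<mu> E \<le> 1"
proof -
  have "(\<Sum>n. \<mu> ^ n / fact n * config_vol U {..<n} E) \<le> (\<Sum>n. inverse (fact n) * (\<mu> * area) ^ n)"
    by (intro suminf_le poisson_term_le assms summable_poisson summable_exp)
  also have "\<dots> = exp (\<mu> * area)" by (simp add: exp_def divide_inverse_commute)
  finally have "poisson_window U \<mu> E \<le> exp (- \<mu> * area) * exp (\<mu> * area)"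
    unfolding poisson_window_def by (intro mult_left_mono) auto
  then show ?thesis by (simp flip: exp_add)
qed

lemma poisson_window_mono:
  assumes "\<mu> \<ge> 0" "measurable_event F"
    and "\<And>P. finite P \<Longrightarrow> P \<subseteq> U \<Longrightarrow> E P \<Longrightarrow> F P"
  shows "poisson_window U \<mu> E \<le> poisson_window U \<mu> F"
proof -
  have "config_vol U {..<n} E \<le> config_vol U {..<n} F" for n
    using assms by (intro config_vol_mono_AE) (auto simp: PiE_iff image_subset_iff)
  then show ?thesis
    unfolding poisson_window_def using assms(1)
    by (intro mult_left_mono suminf_le summable_poisson) auto
qed

lemma poisson_window_disj:
  assumes "\<mu> \<ge> 0" "measurable_event E" "measurable_event F"
  shows "poisson_window U \<mu> (\<lambda>P. E P \<or> F P) \<le> poisson_window U \<mu> E + poisson_window U \<mu> F"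
proof -
  have "\<mu> ^ n / fact n * config_vol U {..<n} (\<lambda>P. E P \<or> F P)
      \<le> \<mu> ^ n / fact n * config_vol U {..<n} E + \<mu> ^ n / fact n * config_vol U {..<n} F" for n
    unfolding distrib_left[symmetric] using assms by (intro mult_left_mono config_vol_disj) auto
  then have "(\<Sum>n. \<mu> ^ n / fact n * config_vol U {..<n} (\<lambda>P. E P \<or> F P))
      \<le> (\<Sum>n. \<mu> ^ n / fact n * config_vol U {..<n} E + \<mu> ^ n / fact n * config_vol U {..<n} F)"
    using assms by (intro suminf_le summable_add summable_poisson)
  then show ?thesis
    unfolding poisson_window_def distrib_left[symmetric]
      suminf_add[OF summable_poisson[OF assms(1)] summable_poisson[OF assms(1)]]
    by (intro mult_left_mono) auto
qed

lemma poisson_window_False: "poisson_window U \<mu> (\<lambda>_. False) = 0"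
  by (simp add: poisson_window_def config_vol_def)

lemma poisson_window_bex:
  assumes "finite S" "\<mu> \<ge> 0" "\<And>s. s \<in> S \<Longrightarrow> measurable_event (E s)"
  shows "poisson_window U \<mu> (\<lambda>P. \<exists>s\<in>S. E s P) \<le> (\<Sum>s\<in>S. poisson_window U \<mu> (E s))"
  using assms(1,3)
proof (induction S)
  case (insert s S)
  have "poisson_window U \<mu> (\<lambda>P. E s P \<or> (\<exists>s\<in>S. E s P))
      \<le> poisson_window U \<mu> (E s) + poisson_window U \<mu> (\<lambda>P. \<exists>s\<in>S. E s P)"
    using insert assms(2) by (intro poisson_window_disj measurable_event_bex) auto
  with insert show ?case by simp
qed (simp add: poisson_window_False)

text \<open>Multiply the two series by the Cauchy product. In degree \<open>k\<close>, giving the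
  first \<open>i\<close> indices to \<open>E\<close> and the rest to \<open>F\<close> bounds each
  term by a summand of the binomial expansion of \<open>(\<mu> + \<nu>) ^ k\<close>.\<close>

lemma poisson_window_superpose:
  assumes "\<mu> \<ge> 0" "\<nu> \<ge> 0" and E: "measurable_event E" and F: "measurable_event F"
  shows "poisson_window U \<mu> E * poisson_window U \<nu> F \<le> poisson_window U (\<mu> + \<nu>) (superpose E F)"
proof -
  let ?a = "\<lambda>n. \<mu> ^ n / fact n * config_vol U {..<n} E"
  let ?b = "\<lambda>n. \<nu> ^ n / fact n * config_vol U {..<n} F"
  let ?c = "\<lambda>n. (\<mu> + \<nu>) ^ n / fact n * config_vol U {..<n} (superpose E F)"
  have na: "summable (\<lambda>n. norm (?a n))" and nb: "summable (\<lambda>n. norm (?b n))"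
    using summable_poisson[OF assms(1)] summable_poisson[OF assms(2)] assms(1,2)
    by (simp_all add: config_vol_nonneg)
  have le: "(\<Sum>i\<le>k. ?a i * ?b (k - i)) \<le> ?c k" for k
  proof -
    let ?V = "config_vol U {..<k} (superpose E F)"
    have "?a i * ?b (k - i) \<le> real (k choose i) * \<mu> ^ i * \<nu> ^ (k - i) / fact k * ?V" if "i \<le> k" for i
    proof -
      have "bij_betw (\<lambda>j. j + i) {..<k - i} {i..<k}"
        using that by (intro bij_betwI[where g = "\<lambda>j. j - i"]) auto
      then have "config_vol U {i..<k} F = config_vol U {..<k - i} F"
        using F by (intro config_vol_reindex) auto
      moreover have "{..<i} \<union> {i..<k} = {..<k}" using that by auto
      ultimately have vol_le: "config_vol U {..<i} E * config_vol U {..<k - i} F \<le> ?V"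
        using config_vol_superpose[of "{..<i}" "{i..<k}" E F] E F by fastforce
      have "?a i * ?b (k - i) = \<mu> ^ i * \<nu> ^ (k - i) / (fact i * fact (k - i))
          * (config_vol U {..<i} E * config_vol U {..<k - i} F)"
        by simp
      also have "\<dots> \<le> \<mu> ^ i * \<nu> ^ (k - i) / (fact i * fact (k - i)) * ?V"
        using assms(1,2) by (intro mult_left_mono vol_le) auto
      also have "\<mu> ^ i * \<nu> ^ (k - i) / (fact i * fact (k - i))
          = real (k choose i) * \<mu> ^ i * \<nu> ^ (k - i) / fact k"
        using that by (simp add: binomial_fact)
      finally show ?thesis .
    qed
    then have "(\<Sum>i\<le>k. ?a i * ?b (k - i))
        \<le> (\<Sum>i\<le>k. real (k choose i) * \<mu> ^ i * \<nu> ^ (k - i) / fact k * ?V)"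
      by (intro sum_mono) simp
    also have "\<dots> = (\<Sum>i\<le>k. real (k choose i) * \<mu> ^ i * \<nu> ^ (k - i)) / fact k * ?V"
      by (simp add: sum_distrib_right sum_divide_distrib)
    also have "\<dots> = ?c k" by (simp add: binomial_ring)
    finally show ?thesis .
  qed
  have "(\<Sum>n. ?a n) * (\<Sum>n. ?b n) = (\<Sum>k. \<Sum>i\<le>k. ?a i * ?b (k - i))"
    by (rule Cauchy_product[OF na nb])
  also have "\<dots> \<le> (\<Sum>n. ?c n)"
    using summable_Cauchy_product[OF na nb] assms(1,2) by (intro suminf_le le summable_poisson) auto
  finally have "exp (- (\<mu> + \<nu>) * area) * ((\<Sum>n. ?a n) * (\<Sum>n. ?b n)) \<le> poisson_window U (\<mu> + \<nu>) (superpose E F)"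
    unfolding poisson_window_def by (intro mult_left_mono) auto
  moreover have "exp (- (\<mu> + \<nu>) * area) = exp (- \<mu> * area) * exp (- \<nu> * area)"
    by (simp add: algebra_simps flip: exp_add)
  ultimately show ?thesis unfolding poisson_window_def by (simp add: ac_simps)
qed

text \<open>Chernoff bound for the Poisson number of points in \<open>T\<close>, obtained by summing
  the bounds for fixed numbers of points into an exponential series.\<close>

lemma poisson_window_count_gt:
  assumes "\<mu> \<ge> 0" "T \<in> sets borel" "t \<ge> 0"
  shows "poisson_window U \<mu> (\<lambda>P. \<not> card (P \<inter> T) \<le> b)
    \<le> exp (\<mu> * (exp t - 1) * measure lborel (U \<inter> T) - t * real b)"
proof -
  let ?B = "area + (exp t - 1) * measure lborel (U \<inter> T)"
  have "\<mu> ^ n / fact n * config_vol U {..<n} (\<lambda>P. \<not> card (P \<inter> T) \<le> b)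
      \<le> exp (- t * real b) * (inverse (fact n) * (\<mu> * ?B) ^ n)" for n
  proof -
    have "\<mu> ^ n / fact n * config_vol U {..<n} (\<lambda>P. \<not> card (P \<inter> T) \<le> b)
        \<le> \<mu> ^ n / fact n * (exp (- t * real b) * ?B ^ n)"
      using config_vol_count_gt[of "{..<n}" T t b] assms by (intro mult_left_mono) simp_all
    also have "\<dots> = exp (- t * real b) * (inverse (fact n) * (\<mu> * ?B) ^ n)"
      by (simp only: power_mult_distrib divide_inverse ac_simps)
    finally show ?thesis .
  qed
  then have "(\<Sum>n. \<mu> ^ n / fact n * config_vol U {..<n} (\<lambda>P. \<not> card (P \<inter> T) \<le> b))
      \<le> (\<Sum>n. exp (- t * real b) * (inverse (fact n) * (\<mu> * ?B) ^ n))"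
    using assms by (intro suminf_le summable_poisson summable_mult summable_exp) auto
  also have "\<dots> = exp (- t * real b) * exp (\<mu> * ?B)"
    by (subst suminf_mult[OF summable_exp]) (simp add: exp_def divide_inverse_commute)
  finally have "poisson_window U \<mu> (\<lambda>P. \<not> card (P \<inter> T) \<le> b)
      \<le> exp (- \<mu> * area) * (exp (- t * real b) * exp (\<mu> * ?B))"
    unfolding poisson_window_def by (intro mult_left_mono) auto
  also have "\<dots> = exp (\<mu> * (exp t - 1) * measure lborel (U \<inter> T) - t * real b)"
    by (simp add: algebra_simps flip: exp_add)
  finally show ?thesis .
qed

text \<open>Compare the series term by term. For \<open>n \<le> N\<close> the weight shrinks by
  \<open>(\<nu> / \<mu>) ^ n\<close>, which is at least \<open>(\<nu> / \<mu>) ^ N\<close>; for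
  larger \<open>n\<close> the term vanishes. The factor \<open>exp (- \<mu> * area)\<close> can only
  grow when the intensity is lowered.\<close>

lemma poisson_window_change_intensity:
  assumes "0 < \<nu>" "\<nu> \<le> \<mu>" and card: "\<And>P. E P \<Longrightarrow> card P \<le> N" and "measurable_event E"
  shows "(\<nu> / \<mu>) ^ N * poisson_window U \<mu> E \<le> poisson_window U \<nu> E"
proof -
  have r: "0 < \<nu> / \<mu>" "\<nu> / \<mu> \<le> 1" using assms by auto
  have termwise: "(\<nu> / \<mu>) ^ N * (\<mu> ^ n / fact n * config_vol U {..<n} E)
      \<le> \<nu> ^ n / fact n * config_vol U {..<n} E" for n
  proof (cases "n \<le> N")
    case True
    then have "(\<nu> / \<mu>) ^ N * \<mu> ^ n \<le> (\<nu> / \<mu>) ^ n * \<mu> ^ n"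
      using r assms by (intro mult_right_mono power_decreasing) auto
    also have "\<dots> = \<nu> ^ n" using assms by (simp add: power_divide)
    finally have "(\<nu> / \<mu>) ^ N * \<mu> ^ n * (config_vol U {..<n} E / fact n) \<le> \<nu> ^ n * (config_vol U {..<n} E / fact n)"
      by (intro mult_right_mono) (simp_all add: config_vol_nonneg)
    then show ?thesis by (simp add: ac_simps)
  next
    case False
    \<comment> \<open>An injective tuple of length \<open>n > N\<close> yields too many points for
      \<open>E\<close>, so on such tuples \<open>E\<close> implies the impossible event.\<close>
    have "config_vol U {..<n} E \<le> config_vol U {..<n} (\<lambda>_. False)"
    proof (rule config_vol_mono_AE)
      fix x :: "nat \<Rightarrow> pt" assume "inj_on x {..<n}" "E (x ` {..<n})"
      then show False using card[of "x ` {..<n}"] False by (simp add: card_image)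
    qed (simp_all add: measurable_event_def)
    then have "config_vol U {..<n} E = 0"
      using config_vol_nonneg[of "{..<n}" E]
      by (simp add: config_vol_def[of _ _ "\<lambda>_. False"])
    then show ?thesis by simp
  qed
  have "(\<nu> / \<mu>) ^ N * (\<Sum>n. \<mu> ^ n / fact n * config_vol U {..<n} E)
      = (\<Sum>n. (\<nu> / \<mu>) ^ N * (\<mu> ^ n / fact n * config_vol U {..<n} E))"
    using assms by (intro suminf_mult[symmetric] summable_poisson) auto
  also have "\<dots> \<le> (\<Sum>n. \<nu> ^ n / fact n * config_vol U {..<n} E)"
    using assms by (intro suminf_le termwise summable_mult summable_poisson) auto
  finally have *: "(\<nu> / \<mu>) ^ N * (\<Sum>n. \<mu> ^ n / fact n * config_vol U {..<n} E)
      \<le> (\<Sum>n. \<nu> ^ n / fact n * config_vol U {..<n} E)" .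
  have "exp (- \<mu> * area) \<le> exp (- \<nu> * area)" using assms by (simp add: mult_right_mono)
  then have "exp (- \<mu> * area) * ((\<nu> / \<mu>) ^ N * (\<Sum>n. \<mu> ^ n / fact n * config_vol U {..<n} E))
     \<le> exp (- \<nu> * area) * (\<Sum>n. \<nu> ^ n / fact n * config_vol U {..<n} E)"
    using * r assms
    by (intro mult_mono mult_nonneg_nonneg suminf_nonneg summable_poisson poisson_term_nonneg) auto
  then show ?thesis by (simp add: poisson_window_def ac_simps)
qed

text \<open>Only the term for exactly one point is kept, with that point placed in
  \<open>V\<close>.\<close>

lemma poisson_window_singleton:
  assumes "\<mu> \<ge> 0" "V \<in> sets borel" "V \<subseteq> U" "measurable_event E" "\<And>x. x \<in> V \<Longrightarrow> E {x}"
  shows "exp (- \<mu> * area) * (\<mu> * measure lborel V) \<le> poisson_window U \<mu> E"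
proof -
  have "bounded V" using U_bounded assms(3) by (rule bounded_subset)
  then have V: "emeasure lborel V = ennreal (measure lborel V)"
    using emeasure_bounded_finite[of V] by (simp add: emeasure_eq_ennreal_measure)
  have "({0::nat} \<rightarrow>\<^sub>E V) \<subseteq> {x \<in> {0} \<rightarrow>\<^sub>E U. E (x ` {0})}"
  proof (rule subsetI)
    fix x :: "nat \<Rightarrow> pt" assume x: "x \<in> {0} \<rightarrow>\<^sub>E V"
    then have "x 0 \<in> V" by (simp add: PiE_iff)
    moreover from this have "x 0 \<in> U" by (rule subsetD[OF assms(3)])
    ultimately show "x \<in> {x \<in> {0} \<rightarrow>\<^sub>E U. E (x ` {0})}"
      using x assms(5)[of "x 0"] by (simp add: PiE_iff)
  qed
  then have "emeasure (lborel_pow {0}) ({0} \<rightarrow>\<^sub>E V) \<le> emeasure (lborel_pow {0}) {x \<in> {0} \<rightarrow>\<^sub>E U. E (x ` {0})}"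
    using assms by (intro emeasure_mono config_sets) auto
  then have "measure lborel V \<le> config_vol U {0} E"
    using emeasure_config[of "{0}" E] assms(2) V
    by (simp add: lborel_pt.emeasure_PiM config_vol_nonneg ennreal_le_iff)
  then have "\<mu> * measure lborel V \<le> (\<Sum>n<2. \<mu> ^ n / fact n * config_vol U {..<n} E)"
    using mult_left_mono[of "measure lborel V" "config_vol U {0} E" \<mu>] assms(1) config_vol_nonneg[of "{}" E]
    by (simp add: numeral_2_eq_2 lessThan_Suc)
  also have "\<dots> \<le> (\<Sum>n. \<mu> ^ n / fact n * config_vol U {..<n} E)"
    using assms(1) by (intro sum_le_suminf summable_poisson poisson_term_nonneg) auto
  finally show ?thesis unfolding poisson_window_def by (intro mult_left_mono) auto
qed

end

section \<open>Rescaling unit intensity to a fixed window\<close>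

lemma scaleR_image_borel:
  fixes U :: "pt set"
  assumes "U \<in> sets borel" "s > 0"
  shows "(*\<^sub>R) s ` U \<in> sets borel"
proof -
  have sU: "(*\<^sub>R) s ` U = (*\<^sub>R) (inverse s) -` U"
  proof (intro set_eqI iffI)
    fix w assume "w \<in> (*\<^sub>R) s ` U"
    then obtain u where "u \<in> U" "w = s *\<^sub>R u" by (rule imageE)
    then show "w \<in> (*\<^sub>R) (inverse s) -` U" using assms(2) by simp
  next
    fix w assume "w \<in> (*\<^sub>R) (inverse s) -` U"
    then show "w \<in> (*\<^sub>R) s ` U"
      using assms(2) by (intro image_eqI[of w _ "inverse s *\<^sub>R w"]) simp_all
  qed
  have "(*\<^sub>R) (inverse s) \<in> borel_measurable (borel :: pt measure)" by measurable
  from measurable_sets[OF this assms(1)] show ?thesis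
    by (simp add: sU)
qed

text \<open>Scaling multiplies the volume for \<open>n\<close> points by
  \<open>s\<^sup>2 ^ n\<close>, a factor that becomes the intensity \<open>s\<^sup>2\<close> in the
  unscaled window.\<close>

lemma poisson_prob_scaleR:
  assumes "window U" "s > 0" "measurable_event E"
  shows "poisson_prob ((*\<^sub>R) s ` U) E = poisson_window U (s\<^sup>2) (\<lambda>P. E ((*\<^sub>R) s ` P))"
proof -
  interpret window U by fact
  have sU_borel: "(*\<^sub>R) s ` U \<in> sets borel"
    by (rule scaleR_image_borel[OF U_borel assms(2)])
  interpret sU: window "(*\<^sub>R) s ` U"
    using sU_borel U_bounded by unfold_locales (auto intro: bounded_scaling)
  have inj: "(*\<^sub>R) s -` (*\<^sub>R) s ` U = U"
    using assms(2) by (intro inj_vimage_image_eq) (auto simp: inj_on_def)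
  have area: "measure lborel ((*\<^sub>R) s ` U) = s\<^sup>2 * area"
    using emeasure_lborel_vimage_scaleR[OF assms(2) sU_borel] inj assms(2)
    by (simp add: emeasure_U sU.emeasure_U power2_eq_square flip: ennreal_mult)
  have vol: "config_vol ((*\<^sub>R) s ` U) I E = s\<^sup>2 ^ card I * config_vol U I (\<lambda>P. E ((*\<^sub>R) s ` P))"
    if "finite I" for I
  proof -
    let ?T = "\<lambda>x. \<lambda>i\<in>I. s *\<^sub>R x i"
    let ?S = "{x \<in> I \<rightarrow>\<^sub>E (*\<^sub>R) s ` U. E (x ` I)}"
    have T: "?T \<in> lborel_pow I \<rightarrow>\<^sub>M lborel_pow I"
    proof (rule measurable_restrict)
      fix i assume "i \<in> I"
      note [measurable] = coordinate_measurable[OF this]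
      show "(\<lambda>x. s *\<^sub>R x i) \<in> lborel_pow I \<rightarrow>\<^sub>M lborel" by measurable
    qed
    have S: "?S \<in> sets (lborel_pow I)" by (rule sU.config_sets[OF that assms(3)])
    have pre: "?T -` ?S \<inter> space (lborel_pow I) = {x \<in> I \<rightarrow>\<^sub>E U. E ((*\<^sub>R) s ` (x ` I))}" (is "?L = ?R")
    proof (rule set_eqI)
      fix x :: "nat \<Rightarrow> pt"
      have "?T x ` I = (*\<^sub>R) s ` (x ` I)" by (simp add: image_image)
      moreover have "s *\<^sub>R w \<in> (*\<^sub>R) s ` U \<longleftrightarrow> w \<in> U" for w using inj by blast
      ultimately show "x \<in> ?L \<longleftrightarrow> x \<in> ?R" by (simp add: space_PiM PiE_iff conj_ac)
    qed
    have "ennreal (config_vol ((*\<^sub>R) s ` U) I E) = emeasure (lborel_pow I) ?S"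
      using sU.emeasure_config[OF that] by simp
    also have "\<dots> = emeasure (scale_measure (ennreal (s\<^sup>2 ^ card I))
        (distr (lborel_pow I) (lborel_pow I) ?T)) ?S"
      using lborel_pow_scaleR[OF assms(2) that] by simp
    also have "\<dots> = ennreal (s\<^sup>2 ^ card I) * emeasure (lborel_pow I) {x \<in> I \<rightarrow>\<^sub>E U. E ((*\<^sub>R) s ` (x ` I))}"
      using T S pre by (simp add: emeasure_distr)
    also have "\<dots> = ennreal (s\<^sup>2 ^ card I * config_vol U I (\<lambda>P. E ((*\<^sub>R) s ` P)))"
      using emeasure_config[OF that, of "\<lambda>P. E ((*\<^sub>R) s ` P)"] by (simp add: ennreal_mult config_vol_nonneg)
    finally show ?thesis
      by (simp add: config_vol_nonneg sU.config_vol_nonneg)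
  qed
  have "poisson_prob ((*\<^sub>R) s ` U) E = (\<Sum>n. exp (- (s\<^sup>2 * area)) *
      ((s\<^sup>2) ^ n / fact n * config_vol U {..<n} (\<lambda>P. E ((*\<^sub>R) s ` P))))"
    unfolding poisson_prob_def area config_vol_def[symmetric] by (simp add: vol)
  also have "\<dots> = poisson_window U (s\<^sup>2) (\<lambda>P. E ((*\<^sub>R) s ` P))"
    unfolding poisson_window_def by (subst suminf_mult[OF summable_poisson]) auto
  finally show ?thesis .
qed

section \<open>Superposition of many copies\<close>

text \<open>A bounded sequence has a convergent subsequence. Each late term lies below an earlier
  subsequence member plus a small error, and above a later one minus a small error, so the whole
  sequence has the same limit.\<close>

lemma convergent_of_asymptotically_decreasing:
  fixes f :: "nat \<Rightarrow> real"
  assumes bdd: "\<And>k. 0 \<le> f k" "\<And>k. f k \<le> B"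
    and decr: "\<And>\<epsilon>. \<epsilon> > 0 \<Longrightarrow> \<exists>k1. \<forall>k\<ge>k1. \<exists>K0. \<forall>K\<ge>K0. f K \<le> f k + \<epsilon>"
  shows "convergent f"
proof -
  have "bounded (range f)"
    using bdd by (intro boundedI[of _ B]) auto
  then obtain L r where r: "strict_mono r" "(f \<circ> r) \<longlonglongrightarrow> L"
    using bounded_imp_convergent_subsequence by blast
  have "f \<longlonglongrightarrow> L"
  proof (rule LIMSEQ_I)
    fix e :: real assume "e > 0"
    then have e: "e / 3 > 0" by simp
    obtain k1 where k1: "\<forall>k\<ge>k1. \<exists>K0. \<forall>K\<ge>K0. f K \<le> f k + e / 3"
      using decr[OF e] by blast
    obtain n0 where n0: "\<And>n. n \<ge> n0 \<Longrightarrow> \<bar>f (r n) - L\<bar> < e / 3"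
      using LIMSEQ_D[OF r(2) e] by auto
    define n where "n = max n0 k1"
    have "k1 \<le> r n" using seq_suble[OF r(1), of n] by (simp add: n_def)
    then obtain K0 where K0: "\<And>K. K \<ge> K0 \<Longrightarrow> f K \<le> f (r n) + e / 3" using k1 by blast
    have "norm (f k - L) < e" if k: "k \<ge> max k1 K0" for k
    proof -
      have up: "f k < L + e"
        using K0[of k] n0[of n] k \<open>e > 0\<close> unfolding n_def by linarith
      \<comment> \<open>For the lower bound the comparison runs the other way: a subsequence member
        beyond \<open>K1\<close> is bounded by \<open>f k\<close>.\<close>
      obtain K1 where K1: "\<And>K. K \<ge> K1 \<Longrightarrow> f K \<le> f k + e / 3" using k1 k by fastforce
      have "f (r (max n0 K1)) \<le> f k + e / 3"
        using seq_suble[OF r(1), of "max n0 K1"] by (intro K1) simp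
      moreover have "\<bar>f (r (max n0 K1)) - L\<bar> < e / 3" by (rule n0) simp
      ultimately show ?thesis unfolding real_norm_def using up \<open>e > 0\<close> by linarith
    qed
    then show "\<exists>no. \<forall>n\<ge>no. norm (f n - L) < e" by blast
  qed
  then show ?thesis by (rule convergentI)
qed

section \<open>Many independent copies\<close>

primrec copies :: "nat \<Rightarrow> (pt set \<Rightarrow> bool) \<Rightarrow> pt set \<Rightarrow> bool" where
  "copies 0 E = (\<lambda>P. P = {})"
| "copies (Suc m) E = superpose (copies m E) E"

lemma measurable_event_copies:
  assumes "measurable_event E"
  shows "measurable_event (copies m E)"
proof (induction m)
  case 0
  then show ?case by (simp add: measurable_event_def)
next
  case (Suc m)
  then show ?case using assms by (simp add: measurable_event_superpose)
qed

lemma copiesE: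
  assumes "copies m E P"
  obtains Q where "\<And>l. l < m \<Longrightarrow> E (Q l)" "disjoint_family_on Q {..<m}" "P = (\<Union>l<m. Q l)"
proof -
  have "\<exists>Q. (\<forall>l<m. E (Q l)) \<and> disjoint_family_on Q {..<m} \<and> P = (\<Union>l<m. Q l)"
    using assms
  proof (induction m arbitrary: P)
    case 0
    then show ?case by (simp add: disjoint_family_on_def)
  next
    case (Suc m)
    then obtain P1 P2 where P: "P = P1 \<union> P2" "P1 \<inter> P2 = {}" "copies m E P1" "E P2"
      by (auto simp: superpose_def)
    from Suc.IH[OF P(3)] obtain Q where
      Q: "\<forall>l<m. E (Q l)" "disjoint_family_on Q {..<m}" "P1 = (\<Union>l<m. Q l)" by blast
    have QP: "Q l \<inter> P2 = {}" if "l < m" for l using P(2) Q(3) that by blast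
    let ?Q = "Q(m := P2)"
    have "disjoint_family_on ?Q {..<Suc m}"
      unfolding disjoint_family_on_def
    proof (intro ballI impI)
      fix i j assume ij: "i \<in> {..<Suc m}" "j \<in> {..<Suc m}" "i \<noteq> j"
      then consider "i < m" "j < m" | "i = m" "j < m" | "i < m" "j = m" by fastforce
      then show "?Q i \<inter> ?Q j = {}"
        using ij Q(2) QP by cases (auto simp: disjoint_family_on_def Int_commute)
    qed
    moreover have "(\<Union>l<m. ?Q l) = (\<Union>l<m. Q l)" by (intro SUP_cong) auto
    then have "P = (\<Union>l<Suc m. ?Q l)"
      unfolding P(1) Q(3) lessThan_Suc by (simp only: UN_insert fun_upd_same Un_commute)
    moreover have "\<forall>l<Suc m. E (?Q l)" using Q(1) P(4) by (simp add: less_Suc_eq)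
    ultimately show ?case by blast
  qed
  with that show ?thesis by blast
qed

lemma (in window) poisson_window_copies:
  assumes "\<mu> \<ge> 0" "measurable_event E"
  shows "poisson_window U \<mu> E ^ m \<le> poisson_window U (real m * \<mu>) (copies m E)"
proof (induction m)
  case 0
  \<comment> \<open>At intensity 0 only the term \<open>n = 0\<close> survives, with
    \<open>0 ^ 0 = 1\<close>; the empty configuration then has probability one.\<close>
  have "poisson_window U 0 (\<lambda>P. P = {}) = (\<Sum>n. config_vol U {..<n} (\<lambda>P. P = {}) / fact n * 0 ^ n)"
    by (simp add: poisson_window_def ac_simps)
  also have "\<dots> = config_vol U {} (\<lambda>P. P = {})" by (subst powser_zero) simp
  also have "\<dots> = 1" by (simp add: config_vol_def measure_def)
  finally show ?case by simp
next
  case (Suc m)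
  have "poisson_window U \<mu> E ^ Suc m \<le> poisson_window U (real m * \<mu>) (copies m E) * poisson_window U \<mu> E"
    unfolding power_Suc2 by (rule mult_right_mono[OF Suc poisson_window_nonneg[OF assms(1)]])
  also have "\<dots> \<le> poisson_window U (real m * \<mu> + \<mu>) (superpose (copies m E) E)"
    using assms by (intro poisson_window_superpose measurable_event_copies) auto
  finally show ?case by (simp add: algebra_simps)
qed

section \<open>The grid and thin annuli\<close>

definition grid_point :: "real \<Rightarrow> pt \<Rightarrow> pt" where
  "grid_point \<rho> w = (\<rho> / 2 * \<lfloor>fst w / (\<rho> / 2)\<rfloor>, \<rho> / 2 * \<lfloor>snd w / (\<rho> / 2)\<rfloor>)"

lemma floor_grid_dist:
  fixes h x :: real
  assumes "h > 0"
  shows "\<bar>h * \<lfloor>x / h\<rfloor> - x\<bar> \<le> h"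
proof -
  have "h * \<lfloor>x / h\<rfloor> \<le> h * (x / h)" using assms by (intro mult_left_mono) auto
  moreover have "h * (x / h) \<le> h * (\<lfloor>x / h\<rfloor> + 1)"
    using assms by (intro mult_left_mono) linarith+
  ultimately show ?thesis using assms by (simp add: distrib_left)
qed

lemma dist_grid_point:
  assumes "\<rho> > 0"
  shows "dist (grid_point \<rho> w) w \<le> \<rho>"
proof -
  have "dist (grid_point \<rho> w) w \<le> dist (fst (grid_point \<rho> w)) (fst w) + dist (snd (grid_point \<rho> w)) (snd w)"
    unfolding dist_prod_def using sqrt_sum_squares_le_sum_abs by (metis abs_of_nonneg zero_le_dist)
  \<comment> \<open>The cells have side \<open>\<rho> / 2\<close> so that the two coordinate errors
    together stay within \<open>\<rho>\<close>.\<close>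
  also have "\<dots> \<le> \<rho> / 2 + \<rho> / 2"
    using floor_grid_dist[of "\<rho> / 2"] assms
    by (intro add_mono) (simp_all add: grid_point_def dist_real_def)
  finally show ?thesis by simp
qed

lemma grid_point_measurable: "grid_point \<rho> \<in> borel_measurable borel"
proof -
  have [measurable]: "fst \<in> borel_measurable (borel :: pt measure)" "snd \<in> borel_measurable (borel :: pt measure)"
    by (intro borel_measurable_continuous_onI continuous_on_fst continuous_on_snd continuous_on_id)+
  show ?thesis
    unfolding grid_point_def[abs_def] by (intro borel_measurable_Pair) measurable
qed

lemma finite_grid_points:
  assumes "bounded U" "\<rho> > 0"
  shows "finite (grid_point \<rho> ` U)"
proof -
  obtain B where B: "\<And>w. w \<in> U \<Longrightarrow> norm w \<le> B" using assms(1) by (auto simp: bounded_iff)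
  let ?h = "\<rho> / 2"
  let ?I = "{\<lfloor>- B / ?h\<rfloor>..\<lfloor>B / ?h\<rfloor>}"
  have fl: "\<lfloor>x / ?h\<rfloor> \<in> ?I" if "\<bar>x\<bar> \<le> B" for x
  proof -
    have "- B / ?h \<le> x / ?h" "x / ?h \<le> B / ?h" using that assms(2) by (intro divide_right_mono; simp)+
    then show ?thesis by (simp add: floor_mono)
  qed
  have "grid_point \<rho> ` U \<subseteq> (\<lambda>(i, j). (?h * real_of_int i, ?h * real_of_int j)) ` (?I \<times> ?I)"
  proof (rule image_subsetI)
    fix w assume "w \<in> U"
    then have "\<bar>fst w\<bar> \<le> B" "\<bar>snd w\<bar> \<le> B"
      using B norm_fst_le[of "fst w" "snd w"] norm_snd_le[of "snd w" "fst w"] by fastforce+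
    then have "(\<lfloor>fst w / ?h\<rfloor>, \<lfloor>snd w / ?h\<rfloor>) \<in> ?I \<times> ?I" using fl by blast
    then show "grid_point \<rho> w \<in> (\<lambda>(i, j). (?h * real_of_int i, ?h * real_of_int j)) ` (?I \<times> ?I)"
      by (rule rev_image_eqI) (simp add: grid_point_def)
  qed
  then show ?thesis by (rule finite_subset) simp
qed

lemma annulus_borel: "annulus \<rho> z j \<in> sets borel"
  by (simp add: annulus_def)

text \<open>The linear factor is the difference of the squares of \<open>j + 7\<close> and
  \<open>j\<close>. While \<open>j * \<rho>\<close> stays bounded the area is of order
  \<open>\<rho>\<close>, so a fine grid makes the annuli thin.\<close>

lemma measure_annulus:
  assumes "\<rho> > 0"
  shows "measure lborel (annulus \<rho> z j) = unit_ball_vol 2 * (14 * real j + 49) * \<rho>\<^sup>2"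
proof -
  have "measure lborel (annulus \<rho> z j)
      = measure lborel (ball z (real (j + 7) * \<rho>)) - measure lborel (ball z (real j * \<rho>))"
    unfolding annulus_def using assms
    by (intro measure_Diff) (auto intro!: subset_ball mult_right_mono simp: emeasure_ball top_unique)
  also have "\<dots> = unit_ball_vol 2 * ((real j + 7) * \<rho>)\<^sup>2 - unit_ball_vol 2 * (real j * \<rho>)\<^sup>2"
    using assms content_ball[of "real (j + 7) * \<rho>" z] content_ball[of "real j * \<rho>" z]
    by (simp add: power2_eq_square)
  also have "\<dots> = unit_ball_vol 2 * (14 * real j + 49) * \<rho>\<^sup>2"
    by (simp add: power2_eq_square algebra_simps)
  finally show ?thesis .
qed

section \<open>Likely regular patterns\<close>

text \<open>A constant grid map makes the pattern trivial: the part has pattern \<open>{0}\<close>,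
  and its complement \<open>{0}\<close> or \<open>{}\<close> according to whether it is inhabited.
  The event is thus a disjunction of two patterned events.\<close>

lemma measurable_event_isolated_part_inside:
  assumes "V \<in> sets borel"
  shows "measurable_event (\<lambda>P. \<exists>C. isolated_part k P C \<and> C \<subseteq> V)"
proof -
  let ?E = "\<lambda>P. \<exists>C. isolated_part k P C \<and> C \<subseteq> V"
  let ?p = "\<lambda>B P. patterned_isolated_part k V (\<lambda>_. 0) {0} B P"
  have "?E P \<longleftrightarrow> ?p {0} P \<or> ?p {} P" for P
  proof
    assume "?E P"
    then obtain C where C: "isolated_part k P C" "C \<subseteq> V" by blast
    then have "C \<noteq> {}" by (simp add: isolated_part_def)
    then have "(\<lambda>_. 0 :: pt) ` C = {0}" by (simp add: image_constant_conv)
    moreover have "(\<lambda>_. 0 :: pt) ` (P - C) = {} \<or> (\<lambda>_. 0 :: pt) ` (P - C) = {0}"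
      by (simp add: image_constant_conv)
    ultimately show "?p {0} P \<or> ?p {} P"
      using C unfolding patterned_isolated_part_def by metis
  next
    assume "?p {0} P \<or> ?p {} P"
    then show "?E P" unfolding patterned_isolated_part_def by metis
  qed
  then have "?E = (\<lambda>P. ?p {0} P \<or> ?p {} P)" by (intro ext)
  moreover have "measurable_event (\<lambda>P. ?p {0} P \<or> ?p {} P)"
    using assms
    by (intro measurable_event_disj measurable_event_patterned_isolated_part) auto
  ultimately show ?thesis by simp
qed

locale window_with_core = window +
  fixes V :: "pt set"
  assumes V_borel: "V \<in> sets borel" and V_subset: "V \<subseteq> U" and V_area: "measure lborel V \<ge> 1"
begin

definition small_part :: "nat \<Rightarrow> pt set \<Rightarrow> bool" where
  "small_part k P \<longleftrightarrow> (\<exists>C. isolated_part k P C \<and> C \<subseteq> V)"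

definition part_prob :: "nat \<Rightarrow> real" where
  "part_prob k = poisson_window U (real k) (small_part k)"

definition rate :: "nat \<Rightarrow> real" where
  "rate k = - ln (part_prob k) / real k"

text \<open>The bound \<open>b\<close> on annuli limits the points lost when copies are merged; the
  bound \<open>N\<close> limits the cost of changing the intensity afterwards.\<close>

definition regular_pattern ::
  "real \<Rightarrow> nat \<Rightarrow> nat \<Rightarrow> nat \<Rightarrow> nat \<Rightarrow> pt set \<Rightarrow> pt set \<Rightarrow> pt set \<Rightarrow> bool" where
  "regular_pattern \<rho> J N b k \<alpha> \<beta> P \<longleftrightarrow>
     patterned_isolated_part k V (grid_point \<rho>) \<alpha> \<beta> P \<and> card P \<le> N \<and>
     (\<forall>z\<in>grid_point \<rho> ` U. \<forall>j\<in>{..J}. card (P \<inter> annulus \<rho> z j) \<le> b)"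

lemma area_ge_1: "area \<ge> 1"
proof -
  have "measure lborel V \<le> area"
    using V_subset V_borel U_borel emeasure_U by (intro measure_mono_fmeasurable) (auto simp: fmeasurable_def)
  with V_area show ?thesis by simp
qed

lemma measurable_event_small_part: "measurable_event (small_part k)"
  unfolding small_part_def[abs_def] using V_borel by (rule measurable_event_isolated_part_inside)

lemma measurable_event_regular_pattern:
  assumes "\<rho> > 0" "finite \<alpha>" "finite \<beta>"
  shows "measurable_event (regular_pattern \<rho> J N b k \<alpha> \<beta>)"
proof -
  have "measurable_event (\<lambda>P. card (P \<inter> UNIV) \<le> N)" by (rule measurable_event_card_le) simp
  then have card: "measurable_event (\<lambda>P. card P \<le> N)" by simp
  show ?thesis
    unfolding regular_pattern_def[abs_def]
    using assms V_borel U_bounded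
    by (intro measurable_event_conj measurable_event_patterned_isolated_part grid_point_measurable card
        measurable_event_ball finite_grid_points measurable_event_card_le annulus_borel) auto
qed

text \<open>A configuration consisting of one point in the core is itself an isolated part, for
  every \<open>k\<close>. This bounds the rate, and it is the yardstick against which irregular
  configurations are negligible.\<close>

lemma exp_le_part_prob:
  assumes "k \<ge> 1"
  shows "exp (- (real k * area)) \<le> part_prob k"
proof -
  have "small_part k {x}" if "x \<in> V" for x
    unfolding small_part_def isolated_part_def using that by (intro exI[of _ "{x}"]) simp
  then have "exp (- real k * area) * (real k * measure lborel V) \<le> part_prob k"
    unfolding part_prob_def using V_borel V_subset measurable_event_small_part
    by (intro poisson_window_singleton) auto
  moreover have "1 * 1 \<le> real k * measure lborel V"
    using assms V_area by (intro mult_mono) auto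
  then have "exp (- real k * area) * 1 \<le> exp (- real k * area) * (real k * measure lborel V)"
    by (intro mult_left_mono) auto
  ultimately have "exp (- real k * area) \<le> part_prob k" by linarith
  then show ?thesis by simp
qed

lemma part_prob_pos: "k \<ge> 1 \<Longrightarrow> part_prob k > 0"
  using exp_le_part_prob[of k] exp_gt_zero[of "- (real k * area)"] by linarith

lemma part_prob_le_1: "part_prob k \<le> 1"
  unfolding part_prob_def by (rule poisson_window_le_1) simp

lemma rate_nonneg: "0 \<le> rate k"
  using part_prob_le_1[of k] part_prob_pos[of k] by (cases "k = 0") (auto simp: rate_def divide_le_0_iff)

lemma rate_le: "rate k \<le> area"
proof (cases "k = 0")
  case False
  then have k: "k \<ge> 1" by simp
  then have "- (real k * area) \<le> ln (part_prob k)"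
    using exp_le_part_prob[OF k] part_prob_pos[OF k] by (metis ln_exp ln_le_cancel_iff exp_gt_zero)
  with k show ?thesis by (simp add: rate_def field_simps)
qed (use area_ge_1 in \<open>simp add: rate_def\<close>)

section \<open>Superposing regular patterns\<close>

lemma copies_regular_pattern_small_part:
  assumes "m > 0" "\<rho> > 0" "\<alpha> \<subseteq> grid_point \<rho> ` U" "\<beta> \<subseteq> grid_point \<rho> ` U"
    and diam: "\<And>v w. v \<in> U \<Longrightarrow> w \<in> U \<Longrightarrow> dist v w \<le> real J * \<rho>"
    and K: "K + 1 + m * b \<le> m * k"
    and P: "finite P" "P \<subseteq> U" and copies: "copies m (regular_pattern \<rho> J N b k \<alpha> \<beta>) P"
  shows "small_part K P"
proof -
  obtain Q where Q: "\<And>l. l < m \<Longrightarrow> regular_pattern \<rho> J N b k \<alpha> \<beta> (Q l)"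
      "disjoint_family_on Q {..<m}" "P = (\<Union>l<m. Q l)"
    using copiesE[OF copies] by metis
  have QP: "Q l \<subseteq> P" if "l < m" for l using Q(3) that by blast
  have "\<exists>C. \<forall>l<m. isolated_part k (Q l) (C l) \<and> C l \<subseteq> V \<and>
      grid_point \<rho> ` C l = \<alpha> \<and> grid_point \<rho> ` (Q l - C l) = \<beta>"
  proof -
    have "\<forall>l. \<exists>C. l < m \<longrightarrow> isolated_part k (Q l) C \<and> C \<subseteq> V \<and>
      grid_point \<rho> ` C = \<alpha> \<and> grid_point \<rho> ` (Q l - C) = \<beta>"
      using Q(1) unfolding regular_pattern_def patterned_isolated_part_def by metis
    then show ?thesis by (rule choice)
  qed
  then obtain C where C: "\<And>l. l < m \<Longrightarrow> isolated_part k (Q l) (C l)" "\<And>l. l < m \<Longrightarrow> C l \<subseteq> V"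
      "\<And>l. l < m \<Longrightarrow> grid_point \<rho> ` C l = \<alpha>" "\<And>l. l < m \<Longrightarrow> grid_point \<rho> ` (Q l - C l) = \<beta>"
    by metis
  have "isolated_part K (\<Union>l<m. Q l) (\<Union>l<m. C l)"
  proof (rule isolated_part_UN[where g = "grid_point \<rho>" and \<alpha> = \<alpha> and \<beta> = \<beta> and J = J and b = b and k = k and \<rho> = \<rho>])
    show "finite (Q l)" if "l < m" for l using QP[OF that] P(1) by (rule finite_subset)
    show "dist v w \<le> real J * \<rho>" if "l < m" "l' < m" "v \<in> Q l" "w \<in> Q l'" for l l' v w
    proof (rule diam)
      show "v \<in> U" using QP[OF that(1)] P(2) that(3) by (meson subsetD)
      show "w \<in> U" using QP[OF that(2)] P(2) that(4) by (meson subsetD)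
    qed
    show "card (Q l \<inter> annulus \<rho> z j) \<le> b" if "l < m" "z \<in> \<alpha> \<union> \<beta>" "j \<le> J" for l z j
    proof -
      have "z \<in> grid_point \<rho> ` U" using that(2) assms(3,4) by (meson UnE subsetD)
      moreover have "\<forall>z\<in>grid_point \<rho> ` U. \<forall>j\<in>{..J}. card (Q l \<inter> annulus \<rho> z j) \<le> b"
        using Q(1)[OF that(1)] unfolding regular_pattern_def by (elim conjE)
      moreover have "j \<in> {..J}" using that(3) by simp
      ultimately show ?thesis by (metis (no_types))
    qed
  qed (use assms Q(2) C dist_grid_point in auto)
  moreover have "(\<Union>l<m. C l) \<subseteq> V" using C(2) by (simp add: UN_subset_iff)
  ultimately show ?thesis unfolding small_part_def Q(3) by metis
qed

lemma copies_regular_pattern_card: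
  assumes "copies m (regular_pattern \<rho> J N b k \<alpha> \<beta>) P"
  shows "card P \<le> N * m"
proof -
  obtain Q where Q: "\<And>l. l < m \<Longrightarrow> regular_pattern \<rho> J N b k \<alpha> \<beta> (Q l)"
      "disjoint_family_on Q {..<m}" "P = (\<Union>l<m. Q l)"
    using copiesE[OF assms] by metis
  have "card P \<le> (\<Sum>l<m. card (Q l))" unfolding Q(3) by (rule card_UN_le) simp
  also have "\<dots> \<le> (\<Sum>l<m. N)" using Q(1) by (intro sum_mono) (simp add: regular_pattern_def)
  finally show ?thesis by (simp add: mult.commute)
qed

text \<open>The \<open>m\<close> copies of intensity \<open>k\<close> form a process of intensity
  \<open>m * k\<close> that contains a part for threshold \<open>K\<close>. Their union has at most
  \<open>N * m\<close> points, so lowering the intensity to \<open>K\<close> costs the first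
  factor.\<close>

lemma superposition_bound:
  assumes "m > 0" "\<rho> > 0" "\<alpha> \<subseteq> grid_point \<rho> ` U" "\<beta> \<subseteq> grid_point \<rho> ` U"
    and diam: "\<And>v w. v \<in> U \<Longrightarrow> w \<in> U \<Longrightarrow> dist v w \<le> real J * \<rho>"
    and K: "K + 1 + m * b \<le> m * k" "K \<ge> 1"
  shows "(real K / (real m * real k)) ^ (N * m) *
    poisson_window U (real k) (regular_pattern \<rho> J N b k \<alpha> \<beta>) ^ m \<le> part_prob K"
proof -
  let ?E = "regular_pattern \<rho> J N b k \<alpha> \<beta>"
  have fin: "finite \<alpha>" "finite \<beta>"
    using finite_grid_points[OF U_bounded assms(2)] assms(3,4) finite_subset by blast+
  have E: "measurable_event ?E" by (intro measurable_event_regular_pattern assms fin)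
  have "K \<le> m * k" using K(1) by linarith
  then have Kmk: "real K \<le> real m * real k" by (metis of_nat_le_iff of_nat_mult)
  have "(real K / (real m * real k)) ^ (N * m) * poisson_window U (real k) ?E ^ m
      \<le> (real K / (real m * real k)) ^ (N * m) * poisson_window U (real m * real k) (copies m ?E)"
    by (intro mult_left_mono poisson_window_copies E) simp_all
  also have "\<dots> \<le> poisson_window U (real K) (copies m ?E)"
    using K(2) Kmk measurable_event_copies[OF E] copies_regular_pattern_card
    by (intro poisson_window_change_intensity) auto
  also have "\<dots> \<le> part_prob K"
    unfolding part_prob_def
  proof (rule poisson_window_mono)
    fix P assume "finite P" "P \<subseteq> U" "copies m ?E P"
    then show "small_part K P"
      by (intro copies_regular_pattern_small_part[OF assms(1-4) diam K(1)])
  qed (simp_all add: measurable_event_small_part)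
  finally show ?thesis .
qed

text \<open>Too many points or a thick annulus together have probability at most half of
  \<open>part_prob k\<close>. The other half is shared by finitely many patterns, so one of them
  gets at least the average.\<close>

lemma ex_likely_regular_pattern:
  fixes \<rho> t :: real
  assumes "\<rho> > 0" "t \<ge> 0" "k \<ge> 1"
  defines "G \<equiv> grid_point \<rho> ` U"
  assumes annuli: "\<And>z j. j \<le> J \<Longrightarrow> (exp t - 1) * measure lborel (U \<inter> annulus \<rho> z j) \<le> 1"
    and N: "real k * (2 * area) + (area + 2) * real k \<le> real N"
    and b: "(area + 3) * real k \<le> t * (real b + 1)"
    and large: "2 * (1 + real (card G) * real (J + 1) * exp t) \<le> exp (2 * real k)"
  shows "\<exists>\<alpha>\<subseteq>G. \<exists>\<beta>\<subseteq>G. part_prob k \<le> 2 * real (card (Pow G \<times> Pow G)) *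
    poisson_window U (real k) (regular_pattern \<rho> J N b k \<alpha> \<beta>)"
proof (rule ccontr)
  let ?pw = "poisson_window U (real k)"
  let ?c = "real (card (Pow G \<times> Pow G))"
  assume "\<not> ?thesis"
  then have gt: "2 * ?c * ?pw (regular_pattern \<rho> J N b k \<alpha> \<beta>) < part_prob k" if "\<alpha> \<subseteq> G" "\<beta> \<subseteq> G" for \<alpha> \<beta>
    using that by (meson not_le)
  have small: "2 * ?c * ?pw (regular_pattern \<rho> J N b k (fst s) (snd s)) < part_prob k"
    if "s \<in> Pow G \<times> Pow G" for s
    using that by (intro gt) (auto simp: mem_Times_iff)
  have finG: "finite G" unfolding G_def by (rule finite_grid_points[OF U_bounded assms(1)])
  have c: "?c > 0" using finG by (simp add: card_cartesian_product card_Pow)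
  let ?many = "\<lambda>P. \<not> card (P \<inter> UNIV) \<le> N"
  let ?thick = "\<lambda>s P. \<not> card (P \<inter> annulus \<rho> (fst s) (snd s)) \<le> b"
  let ?pat = "\<lambda>s. regular_pattern \<rho> J N b k (fst s) (snd s)"
  have pat_meas: "measurable_event (?pat s)" if "s \<in> Pow G \<times> Pow G" for s
    using that finG assms(1) finite_subset by (intro measurable_event_regular_pattern) auto
  have many_meas: "measurable_event ?many"
    by (intro measurable_event_not measurable_event_card_le) simp
  have thick_meas: "measurable_event (?thick s)" for s
    by (intro measurable_event_not measurable_event_card_le annulus_borel)
  have split: "?many P \<or> (\<exists>s\<in>G \<times> {..J}. ?thick s P) \<or> (\<exists>s\<in>Pow G \<times> Pow G. ?pat s P)"
    if P: "P \<subseteq> U" "small_part k P" for P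
  proof (rule ccontr)
    assume "\<not> ?thesis"
    then have not: "card P \<le> N" "\<forall>s\<in>G \<times> {..J}. card (P \<inter> annulus \<rho> (fst s) (snd s)) \<le> b"
        "\<not> (\<exists>s\<in>Pow G \<times> Pow G. ?pat s P)"
      by simp_all
    obtain C where C: "isolated_part k P C" "C \<subseteq> V" using P(2) by (auto simp: small_part_def)
    let ?s = "(grid_point \<rho> ` C, grid_point \<rho> ` (P - C))"
    have "C \<subseteq> U" "P - C \<subseteq> U" using C(2) V_subset P(1) by auto
    then have s: "?s \<in> Pow G \<times> Pow G" unfolding G_def by (simp add: image_mono)
    have "?pat ?s P"
      unfolding regular_pattern_def patterned_isolated_part_def fst_conv snd_conv
    proof (intro conjI exI[of _ C] C refl not(1))
      show "\<forall>z\<in>grid_point \<rho> ` U. \<forall>j\<in>{..J}. card (P \<inter> annulus \<rho> z j) \<le> b"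
      proof (intro ballI)
        fix z j assume "z \<in> grid_point \<rho> ` U" "j \<in> {..J}"
        then have "(z, j) \<in> G \<times> {..J}" by (simp add: G_def)
        with not(2) show "card (P \<inter> annulus \<rho> z j) \<le> b" by (metis fst_conv snd_conv)
      qed
    qed
    then show False using not(3) s by (meson bexI)
  qed
  have "part_prob k \<le> ?pw (\<lambda>P. ?many P \<or> (\<exists>s\<in>G \<times> {..J}. ?thick s P) \<or> (\<exists>s\<in>Pow G \<times> Pow G. ?pat s P))"
    unfolding part_prob_def using split finG
    by (intro poisson_window_mono measurable_event_disj measurable_event_bex many_meas thick_meas pat_meas) simp_all
  also have "\<dots> \<le> ?pw ?many + ?pw (\<lambda>P. (\<exists>s\<in>G \<times> {..J}. ?thick s P) \<or> (\<exists>s\<in>Pow G \<times> Pow G. ?pat s P))"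
    using finG
    by (intro poisson_window_disj measurable_event_disj measurable_event_bex many_meas thick_meas pat_meas) simp_all
  also have "?pw (\<lambda>P. (\<exists>s\<in>G \<times> {..J}. ?thick s P) \<or> (\<exists>s\<in>Pow G \<times> Pow G. ?pat s P))
      \<le> ?pw (\<lambda>P. \<exists>s\<in>G \<times> {..J}. ?thick s P) + ?pw (\<lambda>P. \<exists>s\<in>Pow G \<times> Pow G. ?pat s P)"
    using finG by (intro poisson_window_disj measurable_event_bex thick_meas pat_meas) simp_all
  also have "?pw (\<lambda>P. \<exists>s\<in>G \<times> {..J}. ?thick s P) \<le> (\<Sum>s\<in>G \<times> {..J}. ?pw (?thick s))"
    using finG by (intro poisson_window_bex thick_meas) simp_all
  also have "?pw (\<lambda>P. \<exists>s\<in>Pow G \<times> Pow G. ?pat s P) \<le> (\<Sum>s\<in>Pow G \<times> Pow G. ?pw (?pat s))"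
    using finG by (intro poisson_window_bex pat_meas) simp_all
  finally have total: "part_prob k \<le> ?pw ?many + (\<Sum>s\<in>G \<times> {..J}. ?pw (?thick s)) + (\<Sum>s\<in>Pow G \<times> Pow G. ?pw (?pat s))"
    by simp
  \<comment> \<open>Smaller by the factor \<open>exp (2 * real k)\<close> than the lower bound
    \<open>exp (- (real k * area))\<close> of \<open>part_prob k\<close>; by \<open>large\<close>
    this factor absorbs the number of exceptional events and the factor
    \<open>exp t\<close>.\<close>
  define e where "e = exp (- ((area + 2) * real k))"
  have many: "?pw ?many \<le> e"
  proof -
    \<comment> \<open>Chernoff with parameter 1, counting all points of the window.\<close>
    have "?pw ?many \<le> exp (real k * (exp 1 - 1) * measure lborel (U \<inter> UNIV) - 1 * real N)"
      by (intro poisson_window_count_gt) auto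
    also have "\<dots> \<le> e"
    proof -
      have "exp 1 - 1 \<le> (2 :: real)" using exp_le by simp
      then have "real k * (exp 1 - 1) * area \<le> real k * 2 * area"
        by (intro mult_right_mono mult_left_mono) auto
      then show ?thesis using N by (simp add: e_def)
    qed
    finally show ?thesis .
  qed
  have thick: "?pw (?thick s) \<le> exp t * e" if "s \<in> G \<times> {..J}" for s
  proof -
    let ?a = "measure lborel (U \<inter> annulus \<rho> (fst s) (snd s))"
    have "?pw (?thick s) \<le> exp (real k * (exp t - 1) * ?a - t * real b)"
      using assms(2) by (intro poisson_window_count_gt annulus_borel) auto
    \<comment> \<open>The hypothesis on \<open>b\<close> involves \<open>real b + 1\<close>, since
      \<open>b\<close> will be a rounded-down value; the surplus 1 appears here as
      \<open>exp t\<close>.\<close>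
    also have "\<dots> \<le> exp t * e"
    proof -
      have "real k * ((exp t - 1) * ?a) \<le> real k * 1"
        using that by (intro mult_left_mono annuli) auto
      then show ?thesis using b by (simp add: e_def algebra_simps flip: exp_add)
    qed
    finally show ?thesis .
  qed
  have "(\<Sum>s\<in>G \<times> {..J}. ?pw (?thick s)) \<le> (\<Sum>s\<in>G \<times> {..J}. exp t * e)"
    by (intro sum_mono thick)
  also have "\<dots> = real (card G) * real (J + 1) * exp t * e"
    by (simp add: card_cartesian_product algebra_simps)
  finally have "2 * (?pw ?many + (\<Sum>s\<in>G \<times> {..J}. ?pw (?thick s)))
      \<le> 2 * (1 + real (card G) * real (J + 1) * exp t) * e"
    using many by (simp add: algebra_simps)
  also have "\<dots> \<le> exp (2 * real k) * e"
    using large by (intro mult_right_mono) (simp_all add: e_def)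
  also have "\<dots> = exp (- (real k * area))" by (simp add: e_def algebra_simps flip: exp_add)
  also have "\<dots> \<le> part_prob k" by (rule exp_le_part_prob[OF assms(3)])
  finally have half: "2 * (?pw ?many + (\<Sum>s\<in>G \<times> {..J}. ?pw (?thick s))) \<le> part_prob k" .
  \<comment> \<open>If every pattern fell short of its share, all patterns together would stay
    strictly below half of \<open>part_prob k\<close>.\<close>
  have "(\<Sum>s\<in>Pow G \<times> Pow G. 2 * ?c * ?pw (?pat s)) < (\<Sum>s\<in>Pow G \<times> Pow G. part_prob k)"
    using finG by (intro sum_strict_mono small) auto
  then have "?c * (2 * (\<Sum>s\<in>Pow G \<times> Pow G. ?pw (?pat s))) < ?c * part_prob k"
    by (simp add: sum_distrib_left ac_simps)
  then have rest: "2 * (\<Sum>s\<in>Pow G \<times> Pow G. ?pw (?pat s)) < part_prob k"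
    using c by (simp only: mult_less_cancel_left_pos)
  have "x \<le> a + r \<Longrightarrow> 2 * a \<le> x \<Longrightarrow> 2 * r < x \<Longrightarrow> False" for x a r :: real by linarith
  from this[OF total half rest] show False .
qed

end

section \<open>Convergence of the rates\<close>

context window_with_core
begin

lemma ex_fine_grid:
  assumes "t \<ge> 0"
  shows "\<exists>\<rho>>0. \<exists>J. (\<forall>v\<in>U. \<forall>w\<in>U. dist v w \<le> real J * \<rho>) \<and>
    (\<forall>z. \<forall>j\<le>J. (exp t - 1) * measure lborel (U \<inter> annulus \<rho> z j) \<le> 1)"
proof -
  obtain D0 where D0: "\<And>v w. v \<in> U \<Longrightarrow> w \<in> U \<Longrightarrow> dist v w \<le> D0"
    using U_bounded unfolding bounded_two_points by metis
  define D where "D = max D0 0"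
  \<comment> \<open>Since \<open>\<rho> \<le> 1\<close>, \<open>s * \<rho>\<close> bounds
    \<open>exp t\<close> times the area of every annulus in question; this dictates
    \<open>\<rho> \<le> 1 / s\<close>.\<close>
  define s where "s = exp t * (unit_ball_vol 2 * (14 * (D + 1) + 49))"
  have s: "s > 0" by (simp add: s_def D_def add_nonneg_pos)
  define \<rho> where "\<rho> = min 1 (1 / s)"
  have \<rho>: "0 < \<rho>" "\<rho> \<le> 1" using s by (auto simp: \<rho>_def)
  \<comment> \<open>Rounding up makes \<open>J * \<rho>\<close> cover all distances in
    \<open>U\<close>, while it stays below \<open>D + 1\<close>, which keeps the annuli
    thin.\<close>
  define J where "J = nat \<lceil>D / \<rho>\<rceil>"
  have "D / \<rho> \<ge> 0" using \<rho> by (simp add: D_def)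
  then have J: "D / \<rho> \<le> real J" "real J \<le> D / \<rho> + 1" unfolding J_def by linarith+
  have J1: "D \<le> real J * \<rho>" using J(1) \<rho> by (simp add: field_simps)
  have "real J * \<rho> \<le> (D / \<rho> + 1) * \<rho>" using J(2) \<rho> by (intro mult_right_mono) auto
  also have "\<dots> \<le> D + 1" using \<rho> by (simp add: field_simps)
  finally have J2: "real J * \<rho> \<le> D + 1" .
  have "(exp t - 1) * measure lborel (U \<inter> annulus \<rho> z j) \<le> 1" if "j \<le> J" for z j
  proof -
    have "bounded (annulus \<rho> z j)" unfolding annulus_def by (rule bounded_subset[OF bounded_ball]) auto
    then have "annulus \<rho> z j \<in> fmeasurable lborel"
      using emeasure_bounded_finite annulus_borel by (auto simp: fmeasurable_def)
    then have "measure lborel (U \<inter> annulus \<rho> z j) \<le> measure lborel (annulus \<rho> z j)"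
      using U_borel annulus_borel by (intro measure_mono_fmeasurable) auto
    also have "\<dots> = unit_ball_vol 2 * (14 * (real j * \<rho>) + 49 * \<rho>) * \<rho>"
      using measure_annulus[OF \<rho>(1)] by (simp add: power2_eq_square algebra_simps)
    also have "\<dots> \<le> unit_ball_vol 2 * (14 * (D + 1) + 49) * \<rho>"
    proof -
      have "real j * \<rho> \<le> real J * \<rho>" using that \<rho> by (intro mult_right_mono) auto
      then have "14 * (real j * \<rho>) \<le> 14 * (D + 1)" using J2 by (intro mult_left_mono) linarith+
      moreover have "49 * \<rho> \<le> 49" using \<rho> by simp
      ultimately have "14 * (real j * \<rho>) + 49 * \<rho> \<le> 14 * (D + 1) + 49" by (rule add_mono)
      then show ?thesis using \<rho> by (intro mult_right_mono mult_left_mono) auto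
    qed
    finally have "exp t * measure lborel (U \<inter> annulus \<rho> z j) \<le> exp t * (unit_ball_vol 2 * (14 * (D + 1) + 49) * \<rho>)"
      by (intro mult_left_mono) auto
    also have "\<dots> = s * \<rho>" by (simp add: s_def)
    also have "\<dots> \<le> s * (1 / s)" using s by (intro mult_left_mono) (auto simp: \<rho>_def)
    finally have "exp t * measure lborel (U \<inter> annulus \<rho> z j) \<le> 1" using s by simp
    moreover have "(exp t - 1) * measure lborel (U \<inter> annulus \<rho> z j) \<le> exp t * measure lborel (U \<inter> annulus \<rho> z j)"
      by (intro mult_right_mono) auto
    ultimately show ?thesis by linarith
  qed
  moreover have "dist v w \<le> real J * \<rho>" if "v \<in> U" "w \<in> U" for v w
    using D0[OF that] J1 by (simp add: D_def)
  ultimately show ?thesis using \<rho>(1) by metis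
qed

text \<open>Take logarithms in \<open>bound\<close> and divide by \<open>- real K\<close>. Here
  \<open>r\<close> is the ratio of the two intensities, and the cost of changing between them is
  controlled by \<open>ln r \<le> r - 1\<close>.\<close>

lemma rate_le_of_product_bound:
  assumes "k \<ge> 1" "K \<ge> 1" "c > 0" "p > 0" "part_prob k \<le> c * p"
    and bound: "(real K / (real m * real k)) ^ (C * k * m) * p ^ m \<le> part_prob K"
    and r: "r = real m * real k / real K" "r \<ge> 1"
  shows "rate K \<le> r * (real C * (r - 1) + rate k + ln c / real k)"
proof -
  have r_inv: "real K / (real m * real k) = inverse r" by (simp add: r)
  have r0: "r > 0" using r(2) by simp
  have "real (C * k * m) * ln (inverse r) + real m * ln p = ln (inverse r ^ (C * k * m) * p ^ m)"
    using r0 assms(4) by (simp add: ln_mult ln_realpow)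
  also have "\<dots> \<le> ln (part_prob K)"
    using bound r0 assms(4) part_prob_pos[OF assms(2)] unfolding r_inv by (intro ln_mono) auto
  finally have "- ln (part_prob K) \<le> real (C * k * m) * ln r + real m * (- ln p)"
    using r0 by (simp add: ln_inverse)
  also have "\<dots> \<le> real (C * k * m) * (r - 1) + real m * (real k * rate k + ln c)"
  proof (intro add_mono mult_left_mono)
    show "ln r \<le> r - 1" using ln_le_minus_one[OF r0] .
    have "ln (part_prob k) \<le> ln (c * p)" using assms part_prob_pos[OF assms(1)] by (intro ln_mono) auto
    also have "\<dots> = ln c + ln p" using assms by (simp add: ln_mult)
    finally show "- ln p \<le> real k * rate k + ln c" using assms(1) by (simp add: rate_def)
  qed auto
  finally have "rate K \<le> (real (C * k * m) * (r - 1) + real m * (real k * rate k + ln c)) / real K"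
    unfolding rate_def by (intro divide_right_mono) auto
  also have "\<dots> = r * (real C * (r - 1) + rate k + ln c / real k)"
    using assms(1,2) by (simp add: r(1) field_simps)
  finally show ?thesis .
qed

text \<open>The constants \<open>C\<close>, \<open>\<delta>\<close>, \<open>t\<close>,
  \<open>c\<close> and the grid are fixed before \<open>k\<close>, so the number of patterns does
  not depend on \<open>k\<close>. Then \<open>k\<close> is taken large, then \<open>K\<close> large
  depending on \<open>k\<close>, and finally \<open>m\<close> is chosen to fit
  \<open>K\<close>.\<close>

lemma rate_asymptotically_decreasing:
  fixes \<epsilon> :: real
  assumes "\<epsilon> > 0"
  shows "\<exists>k1. \<forall>k\<ge>k1. \<exists>K0. \<forall>K\<ge>K0. rate K \<le> rate k + \<epsilon>"
proof -
  define C where "C = nat \<lceil>3 * area + 2\<rceil>"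
  have C: "3 * area + 2 \<le> real C" unfolding C_def by linarith
  \<comment> \<open>This is the factor of \<open>\<delta>\<close> in the final estimate,
    \<open>4 * area + 3 * (4 * real C + 1)\<close>, where \<open>rate k \<le> area\<close> and
    \<open>1 + 4 * \<delta> \<le> 3\<close>.\<close>
  define s where "s = 4 * area + 12 * real C + 3"
  have s: "s > 0" using area_ge_1 by (simp add: s_def)
  define \<delta> where "\<delta> = min (1 / 2) (\<epsilon> / s)"
  have "0 < \<delta>" using assms s by (simp add: \<delta>_def)
  moreover have "\<delta> \<le> 1 / 2" unfolding \<delta>_def by (rule min.cobounded1)
  ultimately have \<delta>: "0 < \<delta>" "\<delta> \<le> 1 / 2" .
  have "\<delta> \<le> \<epsilon> / s" unfolding \<delta>_def by (rule min.cobounded2)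
  then have "\<delta> * s \<le> \<epsilon> / s * s" using s by (intro mult_right_mono) auto
  then have \<delta>s: "\<delta> * s \<le> \<epsilon>" using s by simp
  \<comment> \<open>With this \<open>t\<close>, annuli holding more than about
    \<open>\<delta> * k\<close> points are unlikely enough for the hypothesis on \<open>b\<close> in
    \<open>ex_likely_regular_pattern\<close>.\<close>
  define t where "t = (area + 3) / \<delta>"
  have t: "t \<ge> 0" "t * \<delta> = area + 3" using \<delta> area_ge_1 by (auto simp: t_def)
  obtain \<rho> J where \<rho>: "\<rho> > 0" and diam: "\<And>v w. v \<in> U \<Longrightarrow> w \<in> U \<Longrightarrow> dist v w \<le> real J * \<rho>"
    and annuli: "\<And>z j. j \<le> J \<Longrightarrow> (exp t - 1) * measure lborel (U \<inter> annulus \<rho> z j) \<le> 1"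
    using ex_fine_grid[OF t(1)] by metis
  define G where "G = grid_point \<rho> ` U"
  have finG: "finite G" unfolding G_def by (rule finite_grid_points[OF U_bounded \<rho>])
  define c where "c = 2 * real (card (Pow G \<times> Pow G))"
  have c: "c > 0" using finG by (simp add: c_def card_cartesian_product card_Pow)
  define X where "X = 2 * (1 + real (card G) * real (J + 1) * exp t)"
  \<comment> \<open>Ensures \<open>X \<le> real k\<close>, hence
    \<open>X \<le> exp (2 * real k)\<close>, and makes the cost \<open>ln c / real k\<close> of
    fixing a pattern at most \<open>\<delta>\<close>.\<close>
  define k1 where "k1 = nat \<lceil>max X (ln c / \<delta>)\<rceil> + 1"
  have "\<exists>K0. \<forall>K\<ge>K0. rate K \<le> rate k + \<epsilon>" if "k \<ge> k1" for k
  proof -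
    have k: "k \<ge> 1" "X \<le> real k" "ln c / \<delta> \<le> real k" using that unfolding k1_def by linarith+
    have lnc: "ln c / real k \<le> \<delta>" using k \<delta> by (simp add: field_simps)
    have "X \<le> exp (2 * real k)" using k exp_ge_add_one_self[of "2 * real k"] by linarith
    define b where "b = nat \<lfloor>\<delta> * real k\<rfloor>"
    have "\<delta> * real k \<ge> 0" using \<delta> by simp
    then have b: "real b \<le> \<delta> * real k" "\<delta> * real k \<le> real b + 1" unfolding b_def by linarith+
    have bk: "real b \<le> real k / 2"
      using b(1) mult_right_mono[OF \<delta>(2), of "real k"] by simp
    then have bk': "b < k" using k(1) by linarith
    have "\<exists>\<alpha>\<subseteq>G. \<exists>\<beta>\<subseteq>G. part_prob k \<le> c *
      poisson_window U (real k) (regular_pattern \<rho> J (C * k) b k \<alpha> \<beta>)"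
      unfolding G_def c_def
    proof (rule ex_likely_regular_pattern[OF \<rho> t(1) k(1) annuli])
      have "real k * (2 * area) + (area + 2) * real k = (3 * area + 2) * real k"
        by (simp add: algebra_simps)
      also have "\<dots> \<le> real C * real k" using C by (intro mult_right_mono) auto
      finally show "real k * (2 * area) + (area + 2) * real k \<le> real (C * k)" by simp
      have "(area + 3) * real k = t * (\<delta> * real k)" using t(2) by simp
      also have "\<dots> \<le> t * (real b + 1)" using b(2) t(1) by (intro mult_left_mono)
      finally show "(area + 3) * real k \<le> t * (real b + 1)" .
      show "2 * (1 + real (card (grid_point \<rho> ` U)) * real (J + 1) * exp t) \<le> exp (2 * real k)"
        using \<open>X \<le> exp (2 * real k)\<close> by (simp add: X_def G_def)
    qed
    then obtain \<alpha> \<beta> where \<alpha>\<beta>: "\<alpha> \<subseteq> G" "\<beta> \<subseteq> G"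
      and q: "part_prob k \<le> c * poisson_window U (real k) (regular_pattern \<rho> J (C * k) b k \<alpha> \<beta>)"
      by metis
    let ?p = "poisson_window U (real k) (regular_pattern \<rho> J (C * k) b k \<alpha> \<beta>)"
    have "c * ?p > 0" using q part_prob_pos[OF k(1)] by linarith
    then have p: "?p > 0" using c by (simp add: zero_less_mult_iff)
    \<comment> \<open>Makes the rounding error \<open>1 + real k\<close> in \<open>m * k\<close> at
      most \<open>\<delta> * real K\<close>.\<close>
    define K0 where "K0 = nat \<lceil>(1 + real k) / \<delta>\<rceil> + 1"
    have "rate K \<le> rate k + \<epsilon>" if "K \<ge> K0" for K
    proof -
      have K: "K \<ge> 1" "(1 + real k) / \<delta> \<le> real K" using that unfolding K0_def by linarith+
      \<comment> \<open>Each copy is worth \<open>k - b\<close> points after losses. This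
        \<open>m\<close> reaches \<open>K + 1\<close> and overshoots by at most one copy, so
        \<open>m * k / K\<close> is close to 1.\<close>
      define m where "m = (K + 1) div (k - b) + 1"
      have "K + 1 \<le> m * (k - b)"
        unfolding m_def using bk' dividend_less_div_times[of "k - b" "K + 1"] by (simp add: algebra_simps)
      then have Km: "K + 1 + m * b \<le> m * k"
        using bk' by (simp add: diff_mult_distrib2)
      have "m * (k - b) \<le> K + 1 + (k - b)"
        unfolding m_def using div_times_less_eq_dividend[of "K + 1" "k - b"] by simp
      then have "real m * (real k - real b) \<le> real K + 1 + (real k - real b)"
        using bk' by (metis (mono_tags, lifting) less_imp_le of_nat_1 of_nat_add of_nat_diff of_nat_le_iff of_nat_mult)
      moreover have "real m * ((1 - \<delta>) * real k) \<le> real m * (real k - real b)"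
        using b(1) by (intro mult_left_mono) (auto simp: algebra_simps)
      moreover have "1 + real k \<le> \<delta> * real K" using K(2) \<delta> by (simp add: field_simps)
      ultimately have up: "(1 - \<delta>) * (real m * real k) \<le> (1 + \<delta>) * real K"
        by (simp add: algebra_simps)
      define r where "r = real m * real k / real K"
      have "real K \<le> real m * real k"
        using Km by (metis add_leD1 of_nat_le_iff of_nat_mult)
      then have r1: "r \<ge> 1" using K(1) by (simp add: r_def)
      have "(1 - \<delta>) * r \<le> 1 + \<delta>" using up K(1) by (simp add: r_def field_simps)
      \<comment> \<open>Equivalent to \<open>4 * \<delta> * \<delta> \<le> 2 * \<delta>\<close>,
        which is where \<open>\<delta> \<le> 1 / 2\<close> enters.\<close>
      also have "\<dots> \<le> (1 - \<delta>) * (1 + 4 * \<delta>)"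
        using mult_left_mono[OF \<delta>(2), of \<delta>] \<delta>(1) by (simp add: algebra_simps)
      finally have r4: "r \<le> 1 + 4 * \<delta>" using \<delta> by (simp add: mult_le_cancel_left_pos)
      have "rate K \<le> r * (real C * (r - 1) + rate k + ln c / real k)"
      proof (rule rate_le_of_product_bound[OF k(1) K(1) c p q _ r_def r1])
        show "(real K / (real m * real k)) ^ (C * k * m) * ?p ^ m \<le> part_prob K"
          using \<alpha>\<beta> by (intro superposition_bound \<rho> diam Km K(1)) (auto simp: m_def G_def)
      qed
      also have "\<dots> \<le> r * (real C * (4 * \<delta>) + rate k + \<delta>)"
        using r1 r4 lnc by (intro mult_left_mono add_mono) auto
      also have "\<dots> \<le> (1 + 4 * \<delta>) * (real C * (4 * \<delta>) + rate k + \<delta>)"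
        using r4 \<delta> rate_nonneg[of k] by (intro mult_right_mono) auto
      also have "\<dots> = rate k + \<delta> * (4 * rate k + (1 + 4 * \<delta>) * (4 * real C + 1))"
        by (simp add: algebra_simps)
      also have "\<dots> \<le> rate k + \<delta> * (4 * area + 3 * (4 * real C + 1))"
        using rate_le[of k] \<delta> by (intro add_left_mono mult_left_mono add_mono mult_right_mono) auto
      also have "\<dots> \<le> rate k + \<epsilon>" using \<delta>s by (simp add: s_def algebra_simps)
      finally show ?thesis .
    qed
    then show ?thesis by blast
  qed
  then show ?thesis by blast
qed

lemma convergent_rate: "convergent rate"
  using rate_nonneg rate_le rate_asymptotically_decreasing
  by (rule convergent_of_asymptotically_decreasing)

text \<open>Shrinking the box by \<open>sqrt (real k)\<close> turns unit intensity into intensity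
  \<open>k\<close> in the fixed window. At \<open>k = 0\<close> both sides are 0 because division by
  zero gives 0.\<close>

lemma rate_eq:
  "- ln (poisson_prob ((*\<^sub>R) (sqrt (real k)) ` U)
      (\<lambda>P. \<exists>C \<in> knn_components k P. C \<subseteq> (*\<^sub>R) (sqrt (real k)) ` V)) / real k = rate k"
proof (cases "k = 0")
  case False
  then have s: "sqrt (real k) > 0" by simp
  let ?V = "(*\<^sub>R) (sqrt (real k)) ` V"
  have "poisson_prob ((*\<^sub>R) (sqrt (real k)) ` U) (\<lambda>P. \<exists>C \<in> knn_components k P. C \<subseteq> ?V) = part_prob k"
    unfolding component_inside_iff_isolated_part
  proof (subst poisson_prob_scaleR[OF window_axioms s])
    show "measurable_event (\<lambda>P. \<exists>C. isolated_part k P C \<and> C \<subseteq> ?V)"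
      by (intro measurable_event_isolated_part_inside scaleR_image_borel V_borel s)
    show "poisson_window U ((sqrt (real k))\<^sup>2) (\<lambda>P. \<exists>C. isolated_part k ((*\<^sub>R) (sqrt (real k)) ` P) C \<and> C \<subseteq> ?V) = part_prob k"
      unfolding ex_isolated_part_scaleR[OF s] by (simp add: part_prob_def small_part_def[abs_def])
  qed
  then show ?thesis by (simp add: rate_def)
qed (simp add: rate_def)

end

section \<open>Application to the two families of boxes\<close>

lemma scaleR_image_rectangle:
  fixes a b c d :: real
  assumes "s > 0"
  shows "(*\<^sub>R) s ` ({a..b} \<times> {c..d}) = {s * a..s * b} \<times> {s * c..s * d}"
proof -
  have "(*\<^sub>R) s = map_prod ((*) s) ((*) s)" by (simp add: fun_eq_iff)
  then have "(*\<^sub>R) s ` ({a..b} \<times> {c..d}) = ((*) s ` {a..b}) \<times> ((*) s ` {c..d})"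
    by (metis map_prod_surj_on)
  then show ?thesis using assms by simp
qed

lemma window_with_core_rectangles:
  fixes a b c d a' b' c' d' :: real
  assumes "{a'..b'} \<times> {c'..d'} \<subseteq> {a..b} \<times> {c..d}" "a' \<le> b'" "c' \<le> d'" "(b' - a') * (d' - c') \<ge> 1"
  shows "window_with_core ({a..b} \<times> {c..d}) ({a'..b'} \<times> {c'..d'})"
proof
  have "measure lborel ({a'..b'} \<times> {c'..d'}) = (b' - a') * (d' - c')"
    using content_Pair[of a' c' b' d'] assms(2,3) by (simp add: cbox_Pair_eq)
  then show "1 \<le> measure lborel ({a'..b'} \<times> {c'..d'})" using assms by simp
qed (use assms in \<open>auto intro: borel_closed closed_Times bounded_Times\<close>)

lemma convergent_rate_rectangles:
  fixes a b c d a' b' c' d' :: real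
  assumes "{a'..b'} \<times> {c'..d'} \<subseteq> {a..b} \<times> {c..d}" "a' \<le> b'" "c' \<le> d'" "(b' - a') * (d' - c') \<ge> 1"
    and Q: "\<And>k. k > 0 \<Longrightarrow> Q k = {sqrt (real k) * a..sqrt (real k) * b} \<times> {sqrt (real k) * c..sqrt (real k) * d}"
    and Q': "\<And>k. k > 0 \<Longrightarrow> Q' k = {sqrt (real k) * a'..sqrt (real k) * b'} \<times> {sqrt (real k) * c'..sqrt (real k) * d'}"
  shows "convergent (\<lambda>k. - ln (poisson_prob (Q k) (\<lambda>P. \<exists>C \<in> knn_components k P. C \<subseteq> Q' k)) / real k)"
proof -
  interpret window_with_core "{a..b} \<times> {c..d}" "{a'..b'} \<times> {c'..d'}"
    by (rule window_with_core_rectangles[OF assms(1-4)])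
  have "- ln (poisson_prob (Q k) (\<lambda>P. \<exists>C \<in> knn_components k P. C \<subseteq> Q' k)) / real k = rate k" for k
  proof (cases "k = 0")
    case True
    then show ?thesis by (simp add: rate_def)
  next
    case False
    then have "k > 0" "sqrt (real k) > 0" by auto
    then show ?thesis
      using rate_eq[of k] Q[of k] Q'[of k] by (simp only: scaleR_image_rectangle)
  qed
  then show ?thesis using convergent_rate by simp
qed

theorem theorem2:
  fixes M :: real
  assumes "good_M M"
  shows "convergent (\<lambda>k. f1 M k) \<and> convergent (\<lambda>k. min (f1 M k) (f2 M k))"
proof -
  have M: "M \<ge> 40" using assms by (simp add: good_M_def)
  then have "40 * 40 \<le> M * M" by (intro mult_mono) auto
  \<comment> \<open>After rescaling, both cores have area \<open>M * M / 4\<close>, comfortably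
    above the required 1.\<close>
  then have MM: "1 \<le> (M / 4 - - (M / 4)) * (M / 4 - - (M / 4))" "1 \<le> (M / 2 - 0) * (M / 4 - - (M / 4))"
    by simp_all
  have f1: "convergent (\<lambda>k. f1 M k)"
    unfolding f1_def p1_def
  proof (rule convergent_rate_rectangles[OF _ _ _ MM(1)])
    fix k :: nat
    show "boxS M k = {sqrt (real k) * - (M / 2)..sqrt (real k) * (M / 2)} \<times>
        {sqrt (real k) * - (M / 2)..sqrt (real k) * (M / 2)}"
      by (auto simp: boxS_def abs_le_iff mult.commute)
    show "boxS' M k = {sqrt (real k) * - (M / 4)..sqrt (real k) * (M / 4)} \<times>
        {sqrt (real k) * - (M / 4)..sqrt (real k) * (M / 4)}"
      by (auto simp: boxS'_def abs_le_iff mult.commute)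
  qed (use M in auto)
  have f2: "convergent (\<lambda>k. f2 M k)"
    unfolding f2_def p2_def
  proof (rule convergent_rate_rectangles[OF _ _ _ MM(2)])
    fix k :: nat
    show "boxR M k = {sqrt (real k) * 0..sqrt (real k) * M} \<times>
        {sqrt (real k) * - (M / 2)..sqrt (real k) * (M / 2)}"
      by (auto simp: boxR_def abs_le_iff mult.commute)
    show "boxR' M k = {sqrt (real k) * 0..sqrt (real k) * (M / 2)} \<times>
        {sqrt (real k) * - (M / 4)..sqrt (real k) * (M / 4)}"
      by (auto simp: boxR'_def abs_le_iff mult.commute)
  qed (use M in auto)
  \<comment> \<open>Both rates converge separately, and the minimum is continuous.\<close>
  have "convergent (\<lambda>k. min (f1 M k) (f2 M k))"
    using tendsto_min[OF f1[unfolded convergent_LIMSEQ_iff] f2[unfolded convergent_LIMSEQ_iff]]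
    by (rule convergentI)
  with f1 show ?thesis by blast
qed

end
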